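(* Let $\alpha\in(0,1)$. Consider score functions $S_y:\mathbb R^d\to\mathbb R$, $y\in\mathcal Y$, computed from an independent training sample (so they are treated as fixed; all probabilities are conditional on the training sample), such that the scores $S_{Y_i}(X_i)$, $1\le i\le n+m$, have no ties almost surely and, when $\mathcal Y=\mathbb R$, for every $x$ the map $y\mapsto S_y(x)$ is right-continuous with left limits. Consider an informative collection $\mathcal I$ which is monotone with respect to the considered $p$-value collection $\mathbf p$, in the sense that: (i) if $\mathcal C'\subset\mathcal C$ are subsets of $\{1,\dots,K\}$ (classification) or intervals of $\mathbb R$ (regression) and $\mathcal C\in\mathcal I$, then $\mathcal C'\in\mathcal I$; (ii) almost surely, for each $i$, $t\in(0,1]\mapsto\mathbf 1\{\mathcal C^{t}_{n+i}(\mathbf p)\in\mathcal I\}$ is right-continuous; (iii) in regression, for all $t\in(0,1)$, almost surely $\mathcal C^{t}_{n+i}(\mathbf p)$ is an interval. (a) (iid model, regression $\mathcal Y=\mathbb R$ or classification $\mathcal Y=\{1,\dots,K\}$.) If $\mathbf p=\overline{\mathbf p}$ is the full-calibrated $p$-value collection, then the $\mathcal I$-informative selective prediction set procedure $\mathcal R^{\mathrm{InfoSP}}_\alpha(\overline{\mathbf p})$ satisfies, for every distribution $P_{XY}$, $$\mathbb E_{(X,Y)\sim P_{XY}}\big[\mathrm{FCP}(\mathcal R^{\mathrm{InfoSP}}_\alpha(\overline{\mathbf p}),Y)\big]\le\alpha .$$ (b) (class-conditional model, classification $\mathcal Y=\{1,\dots,K\}$.) If $\mathbf p=\widetilde{\mathbf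 p}$ is the class-calibrated $p$-value collection, then the $\mathcal I$-informative selective prediction set procedure $\mathcal R^{\mathrm{InfoSP}}_\alpha(\widetilde{\mathbf p})$ satisfies, for all class-conditional distributions $(P_{X|Y=k})_{k}$ and all deterministic label vectors $Y=(Y_1,\dots,Y_{n+m})$, $$\mathbb E_{X\sim P_{X|Y}}\big[\mathrm{FCP}(\mathcal R^{\mathrm{InfoSP}}_\alpha(\widetilde{\mathbf p}),Y)\big]\le\alpha .$$
   Context: Data: calibration sample $(X_j,Y_j)$, $j\in\{1,\dots,n\}$, fully observed; test sample $(X_{n+i},Y_{n+i})$, $i\in\{1,\dots,m\}$, of which only the $X_{n+i}$ are observed. Covariates lie in $\mathbb R^d$, outcomes in $\mathcal Y$, with $\mathcal Y=\mathbb R$ (regression) or $\mathcal Y=\{1,\dots,K\}$ (classification). iid model: $(X_i,Y_i)\sim P_{XY}$, $1\le i\le n+m$, are iid. Class-conditional model (classification only): the labels $Y_1,\dots,Y_{n+m}$ are deterministic and $X_1,\dots,X_{n+m}$ are mutually independent with $X_j\sim P_{X|Y=Y_j}$. Full-calibrated $p$-values $\overline{\mathbf p}$: $\overline p^{(y)}_i=\frac1{n+1}\big(1+\sum_{j=1}^n\mathbf 1\{S_{Y_j}(X_j)\ge S_y(X_{n+i})\}\big)$, $1\le i\le m$, $y\in\mathcal Y$. Class-calibrated $p$-values $\widetilde{\mathbf p}$ (classification): $\widetilde p^{(y)}_i=\frac1{|\mathcal D^{(y)}|+1}\big(1+\sum_{j\in\mathcal D^{(y)}}\mathbf 1\{S_y(X_j)\ge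 S_y(X_{n+i})\}\big)$ with $\mathcal D^{(y)}=\{j\le n: Y_j=y\}$. For a $p$-value collection $\mathbf p=(p_i^{(y)})$ and a level $t$, $\mathcal C^{t}_{n+i}(\mathbf p)=\{y\in\mathcal Y: p^{(y)}_i>t\}$. $\mathcal I$ is a prespecified collection of subsets of $\mathcal Y$ (intervals if $\mathcal Y=\mathbb R$), called informative. $\mathcal I$-adjusted $p$-values: $\mathbf q=(q_i)_{1\le i\le m}$, $q_i=\min\{t\in(0,1]:\mathcal C^t_{n+i}(\mathbf p)\in\mathcal I\}$, with $q_i=1$ if the set is empty. BH procedure at level $\alpha$: $\mathrm{BH}(\mathbf q)=\{i: q_i\le\alpha\hat\ell/m\}$, where $\hat\ell=\max\{\ell\in\{1,\dots,m\}: q_{(\ell)}\le\alpha\ell/m\}$ ($\hat\ell=0$ if no such $\ell$) and $q_{(1)}\le\dots\le q_{(m)}$ are the ordered $q_i$'s; then $|\mathrm{BH}(\mathbf q)|=\hat\ell$. InfoSP: $\mathcal R^{\mathrm{InfoSP}}_\alpha(\mathbf p)=\big(\mathcal C^{\alpha|\mathrm{BH}(\mathbf q)|/m}_{n+i}(\mathbf p)\big)_{i\in\mathrm{BH}(\mathbf q)}$. A selective prediction set procedure is $\mathcal R=(\mathcal C_{n+i})_{i\in\mathcal S}$ with $\mathcal S\subset\{1,\dots,m\}$ and $\mathcal C_{n+i}\subset\mathcal Y$, depending only on the observed data; it is $\mathcal I$-informative if $\mathcal C_{n+i}\in\mathcal I$ for all $i\in\mathcal S$. Its false coverage proportion is $\mathrm{FCP}(\mathcal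 R,Y)=\frac{\sum_{i\in\mathcal S}\mathbf 1\{Y_{n+i}\notin\mathcal C_{n+i}\}}{\max(1,|\mathcal S|)}$.
   Formalization: In the regression case the adjusted p-values q_i are additionally assumed measurable (up to null sets of the joint law), since for an arbitrary monotone collection of intervals the false coverage proportion may be nonmeasurable and its expectation undefined. *)

theory Defs
  imports "HOL-Probability.Probability"
begin

text \<open>
  Index convention: positions \<open>1, \<dots>, n\<close> of a sample are the calibration points and position
  \<open>n + i\<close>, with \<open>1 \<le> i \<le> m\<close>, is the \<open>i\<close>-th test point. A sample is a pair of sequences \<open>X\<close>
  (covariates) and \<open>Y\<close> (labels); the p-values read \<open>Y\<close> only at positions \<open>1, \<dots>, n\<close>, so every
  procedure computed from them depends on the observed data only.
\<close>

definition full_pvalue ::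
  "('y \<Rightarrow> 'x \<Rightarrow> real) \<Rightarrow> nat \<Rightarrow> (nat \<Rightarrow> 'x) \<Rightarrow> (nat \<Rightarrow> 'y) \<Rightarrow> nat \<Rightarrow> 'y \<Rightarrow> real" where
  "full_pvalue S n X Y i y =
     (1 + (\<Sum>j = 1..n. of_bool (S (Y j) (X j) \<ge> S y (X (n + i))))) / (real n + 1)"

definition class_pvalue ::
  "('y \<Rightarrow> 'x \<Rightarrow> real) \<Rightarrow> nat \<Rightarrow> (nat \<Rightarrow> 'x) \<Rightarrow> (nat \<Rightarrow> 'y) \<Rightarrow> nat \<Rightarrow> 'y \<Rightarrow> real" where
  "class_pvalue S n X Y i y =
     (let D = {j \<in> {1..n}. Y j = y} in
       (1 + (\<Sum>j\<in>D. of_bool (S y (X j) \<ge> S y (X (n + i))))) / (real (card D) + 1))"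

definition pred_set :: "'y set \<Rightarrow> (nat \<Rightarrow> 'y \<Rightarrow> real) \<Rightarrow> real \<Rightarrow> nat \<Rightarrow> 'y set" where
  "pred_set \<Y> p t i = {y \<in> \<Y>. p i y > t}"

text \<open>
  The infimum below is a minimum whenever one exists. Under right-continuity of the indicator of
  \<open>pred_set \<Y> p t i \<in> I\<close> the only exception is the degenerate case in which that set of levels is
  not bounded away from \<open>0\<close> (e.g. \<open>\<Y> \<in> I\<close>), where the value is \<open>0\<close>.
\<close>

definition adj_pvalue :: "'y set \<Rightarrow> 'y set set \<Rightarrow> (nat \<Rightarrow> 'y \<Rightarrow> real) \<Rightarrow> nat \<Rightarrow> real" where
  "adj_pvalue \<Y> I p i =
     (let T = {t \<in> {0<..1}. pred_set \<Y> p t i \<in> I} in if T = {} then 1 else Inf T)"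

definition order_stat :: "nat \<Rightarrow> (nat \<Rightarrow> real) \<Rightarrow> nat \<Rightarrow> real" where
  "order_stat m q l = sort (map q [1..<Suc m]) ! (l - 1)"

definition BH_count :: "real \<Rightarrow> nat \<Rightarrow> (nat \<Rightarrow> real) \<Rightarrow> nat" where
  "BH_count \<alpha> m q = Max ({0} \<union> {l \<in> {1..m}. order_stat m q l \<le> \<alpha> * real l / real m})"

definition BH :: "real \<Rightarrow> nat \<Rightarrow> (nat \<Rightarrow> real) \<Rightarrow> nat set" where
  "BH \<alpha> m q = {i \<in> {1..m}. q i \<le> \<alpha> * real (BH_count \<alpha> m q) / real m}"

text \<open>
  A selective prediction set procedure is a pair of the selected set of test indices and a family
  of prediction sets, of which only the members at selected indices matter.
\<close>

type_synonym 'y selective = "nat set \<times> (nat \<Rightarrow> 'y set)"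

definition InfoSP ::
  "real \<Rightarrow> nat \<Rightarrow> 'y set \<Rightarrow> 'y set set \<Rightarrow> (nat \<Rightarrow> 'y \<Rightarrow> real) \<Rightarrow> 'y selective" where
  "InfoSP \<alpha> m \<Y> I p =
     (let B = BH \<alpha> m (adj_pvalue \<Y> I p)
      in (B, pred_set \<Y> p (\<alpha> * real (card B) / real m)))"

definition informative :: "'y set set \<Rightarrow> 'y selective \<Rightarrow> bool" where
  "informative I R \<longleftrightarrow> (\<forall>i\<in>fst R. snd R i \<in> I)"

definition FCP :: "nat \<Rightarrow> 'y selective \<Rightarrow> (nat \<Rightarrow> 'y) \<Rightarrow> real" where
  "FCP n R Y = (\<Sum>i\<in>fst R. of_bool (Y (n + i) \<notin> snd R i)) / max 1 (real (card (fst R)))"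

text \<open>
  \<open>A\<close> is the class of admissible prediction sets: all subsets of \<open>{1..K}\<close> in classification (so
  that the last conjunct is trivially true), all intervals in regression. \<open>p\<close> is the random
  p-value collection, a function of the outcome in \<open>M\<close>.
\<close>

definition monotone_collection ::
  "'a measure \<Rightarrow> nat \<Rightarrow> 'y set \<Rightarrow> 'y set set \<Rightarrow> 'y set set \<Rightarrow> ('a \<Rightarrow> nat \<Rightarrow> 'y \<Rightarrow> real) \<Rightarrow> bool" where
  "monotone_collection M m \<Y> A I p \<longleftrightarrow>
     (\<forall>C\<in>A. \<forall>C'\<in>A. C' \<subseteq> C \<and> C \<in> I \<longrightarrow> C' \<in> I) \<and>
     (AE z in M. \<forall>i\<in>{1..m}. \<forall>t\<in>{0<..1}.
        continuous (at t within {t..1}) (\<lambda>s. of_bool (pred_set \<Y> (p z) s i \<in> I) :: real)) \<and>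
     (\<forall>t\<in>{0<..<1}. AE z in M. \<forall>i\<in>{1..m}. pred_set \<Y> (p z) t i \<in> A)"

definition cadlag :: "(real \<Rightarrow> real) \<Rightarrow> bool" where
  "cadlag f \<longleftrightarrow> (\<forall>y. continuous (at_right y) f \<and> (\<exists>l. (f \<longlongrightarrow> l) (at_left y)))"

definition iid_law :: "nat \<Rightarrow> 'a measure \<Rightarrow> (nat \<Rightarrow> 'a) measure" where
  "iid_law N P = PiM {1..N} (\<lambda>_. P)"

text \<open>Joint law of the covariates given the labels \<open>Y\<close>, where \<open>PX k\<close> is the law of \<open>X\<close> given \<open>Y = k\<close>.\<close>

definition class_cond_law :: "nat \<Rightarrow> ('y \<Rightarrow> 'x measure) \<Rightarrow> (nat \<Rightarrow> 'y) \<Rightarrow> (nat \<Rightarrow> 'x) measure" where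
  "class_cond_law N PX Y = PiM {1..N} (\<lambda>j. PX (Y j))"

text \<open>
  Integrability makes the expectation meaningful: the Bochner integral of a function that is not
  integrable is \<open>0\<close> by convention.
\<close>

definition FCP_controlled ::
  "'a measure \<Rightarrow> real \<Rightarrow> nat \<Rightarrow> ('a \<Rightarrow> 'y selective) \<Rightarrow> ('a \<Rightarrow> nat \<Rightarrow> 'y) \<Rightarrow> bool" where
  "FCP_controlled M \<alpha> n R Y \<longleftrightarrow>
     integrable M (\<lambda>z. FCP n (R z) (Y z)) \<and> (\<integral>z. FCP n (R z) (Y z) \<partial>M) \<le> \<alpha>"

end

theory Submission
  imports Defs
begin

text \<open>
  The procedure reports prediction sets at the level $\alpha \ell / m$, where $\ell$ is the number of
  selections that Benjamini--Hochberg makes on the adjusted p-values. A selected test point $i$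
  is thus covered falsely exactly when the p-value of its true label is at most
  $\alpha \ell / m$, and the claim is that each test point contributes at most $\alpha / m$ to the
  expected proportion.

  Two facts make this work. First, when $i$ is selected, $\ell$ does not change if the adjusted
  p-value $q_i$ is replaced by $0$ (\<open>BH_count_upd_zero\<close>); write $g$ for the resulting number. So the
  contribution of $i$ is at most $1/g$ on the event that the true p-value is at most $\alpha g / m$.
  Secondly, the observation at position $n + i$ is exchangeable with those calibrating
  its true p-value. Exchanging it with each of these in turn lets the true p-value
  run through the normalised ranks of the pooled scores (\<open>conformal_pvalue_transpose_rank\<close>), while
  a larger score in the test position takes that score out of the calibration set, which means smaller
  p-values at all other test points (\<open>conformal_pvalue_transpose_mono\<close>), smaller adjusted p-values
  (\<open>adj_pvalue_mono\<close>, from the monotonicity of the informative collection), and a larger $g$.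
  Hence $g$ decreases in the true p-value, and the average over the exchanges is at most
  $\alpha / m$ by an elementary inequality on ranks (\<open>sum_rank_threshold_le\<close>). That the
  expectation equals the expectation of this average is the invariance of the law
  (\<open>integral_le_of_orbit_average_le\<close>).

  The two calibration schemes differ only in the set of positions with which a test point is
  exchanged: all calibration points in the iid model, those of the same class in the
  class-conditional model. The abstract bound is \<open>InfoSP_controls_FCP\<close>. Informativeness of the
  reported sets comes from right-continuity in the level, since the adjusted p-value of a
  selected point is at most the reported level, which is at most $\alpha < 1$.
\<close>

section \<open>Counting form of the Benjamini--Hochberg procedure\<close>

text \<open>
  The values that are at most $c$ form an initial segment of a sorted list, so comparing one
  entry with $c$ amounts to comparing its position with the length of that segment.
\<close>

lemma sorted_nth_le_iff:
  fixes xs :: "real list"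
  assumes "sorted xs" "k < length xs"
  shows "xs ! k \<le> c \<longleftrightarrow> k < length (filter (\<lambda>x. x \<le> c) xs)"
proof -
  let ?S = "{i. i < length xs \<and> xs ! i \<le> c}"
  have len: "length (filter (\<lambda>x. x \<le> c) xs) = card ?S"
    by (simp add: length_filter_conv_card)
  show ?thesis
  proof
    assume le: "xs ! k \<le> c"
    have "xs ! i \<le> c" if "i \<le> k" for i
      using sorted_nth_mono[OF assms(1) that assms(2)] le by simp
    then have "{..k} \<subseteq> ?S" using assms(2) by auto
    then have "card {..k} \<le> card ?S" by (intro card_mono) auto
    then show "k < length (filter (\<lambda>x. x \<le> c) xs)" by (simp add: len)
  next
    assume lt: "k < length (filter (\<lambda>x. x \<le> c) xs)"
    show "xs ! k \<le> c"
    proof (rule ccontr)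
      assume "\<not> xs ! k \<le> c"
      then have "\<not> xs ! i \<le> c" if "k \<le> i" "i < length xs" for i
        using sorted_nth_mono[OF assms(1) that] by simp
      then have "?S \<subseteq> {..<k}" by (auto simp: not_less[symmetric])
      then have "card ?S \<le> k" using card_mono[of "{..<k}" ?S] by simp
      then show False using lt len by simp
    qed
  qed
qed

text \<open>
  This removes sorting from the procedure: from here on only the counts
  \<open>card {i. q i \<le> c}\<close> matter, and these are plainly monotone and measurable in \<open>q\<close>.
\<close>

lemma order_stat_le_iff:
  assumes "l \<in> {1..m}"
  shows "order_stat m q l \<le> c \<longleftrightarrow> l \<le> card {i \<in> {1..m}. q i \<le> c}"
proof -
  have "length (filter (\<lambda>x. x \<le> c) (sort (map q [1..<Suc m])))
      = length (filter (\<lambda>i. q i \<le> c) [1..<Suc m])"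
    by (simp add: filter_sort filter_map o_def)
  also have "\<dots> = card (set (filter (\<lambda>i. q i \<le> c) [1..<Suc m]))"
    by (rule distinct_card[symmetric]) simp
  also have "set (filter (\<lambda>i. q i \<le> c) [1..<Suc m]) = {i \<in> {1..m}. q i \<le> c}"
    by auto
  finally have len: "length (filter (\<lambda>x. x \<le> c) (sort (map q [1..<Suc m])))
    = card {i \<in> {1..m}. q i \<le> c}" .
  show ?thesis
    using assms unfolding order_stat_def
    by (subst sorted_nth_le_iff) (auto simp: len[unfolded One_nat_def] simp del: upt_Suc)
qed

lemma BH_count_eq:
  "BH_count \<alpha> m q =
     Max ({0} \<union> {l \<in> {1..m}. l \<le> card {i \<in> {1..m}. q i \<le> \<alpha> * real l / real m}})"
  unfolding BH_count_def by (rule arg_cong[of _ _ Max]) (auto simp: order_stat_le_iff)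

lemma BH_count_geI:
  assumes "l \<le> m" "l \<le> card {i \<in> {1..m}. q i \<le> \<alpha> * real l / real m}"
  shows "l \<le> BH_count \<alpha> m q"
  unfolding BH_count_eq using assms by (cases l) (auto intro!: Max_ge)

lemma BH_count_le: "BH_count \<alpha> m q \<le> m"
  unfolding BH_count_eq by (subst Max_le_iff) auto

lemma BH_count_le_card:
  "BH_count \<alpha> m q \<le> card {i \<in> {1..m}. q i \<le> \<alpha> * real (BH_count \<alpha> m q) / real m}"
proof -
  have "BH_count \<alpha> m q \<in> {0} \<union> {l \<in> {1..m}. l \<le> card {i \<in> {1..m}. q i \<le> \<alpha> * real l / real m}}"
    (is "_ \<in> ?L")
    unfolding BH_count_eq by (rule Max_in) auto
  then show ?thesis by auto
qed

lemma finite_BH: "finite (BH \<alpha> m q)"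
  by (simp add: BH_def)

text \<open>
  The selected set consists of the indices below the threshold of \<open>BH_count\<close>, hence has at least
  that many elements. If it had strictly more, its own cardinality would be an admissible
  count (the thresholds grow with the count), contradicting maximality.
\<close>

lemma card_BH:
  assumes "0 \<le> \<alpha>"
  shows "card (BH \<alpha> m q) = BH_count \<alpha> m q"
proof (rule antisym)
  show "BH_count \<alpha> m q \<le> card (BH \<alpha> m q)"
    using BH_count_le_card by (simp add: BH_def)
  show "card (BH \<alpha> m q) \<le> BH_count \<alpha> m q"
  proof (rule ccontr)
    assume "\<not> card (BH \<alpha> m q) \<le> BH_count \<alpha> m q"
    then have "\<alpha> * real (BH_count \<alpha> m q) / real m \<le> \<alpha> * real (card (BH \<alpha> m q)) / real m"
      using assms by (intro divide_right_mono mult_left_mono) auto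
    then have "BH \<alpha> m q \<subseteq> {i \<in> {1..m}. q i \<le> \<alpha> * real (card (BH \<alpha> m q)) / real m}"
      by (auto simp: BH_def)
    then have "card (BH \<alpha> m q) \<le> card {i \<in> {1..m}. q i \<le> \<alpha> * real (card (BH \<alpha> m q)) / real m}"
      by (intro card_mono) auto
    moreover have "card (BH \<alpha> m q) \<le> m"
      using card_mono[of "{1..m}" "BH \<alpha> m q"] by (simp add: BH_def subset_iff)
    ultimately show False
      using BH_count_geI \<open>\<not> _\<close> by blast
  qed
qed

lemma BH_count_antimono:
  assumes "\<And>i. i \<in> {1..m} \<Longrightarrow> q i \<le> q' i"
  shows "BH_count \<alpha> m q' \<le> BH_count \<alpha> m q"
proof (rule BH_count_geI)
  let ?t = "\<alpha> * real (BH_count \<alpha> m q') / real m"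
  have "BH_count \<alpha> m q' \<le> card {i \<in> {1..m}. q' i \<le> ?t}"
    by (rule BH_count_le_card)
  also have "\<dots> \<le> card {i \<in> {1..m}. q i \<le> ?t}"
    using assms by (intro card_mono) (auto intro: order_trans)
  finally show "BH_count \<alpha> m q' \<le> card {i \<in> {1..m}. q i \<le> ?t}" .
qed (rule BH_count_le)

lemma BH_count_upd_zero_pos:
  assumes "0 \<le> \<alpha>" "i \<in> {1..m}"
  shows "1 \<le> BH_count \<alpha> m (q(i := 0))"
proof (rule BH_count_geI)
  have "card {i} \<le> card {k \<in> {1..m}. (q(i := 0)) k \<le> \<alpha> * real 1 / real m}"
    using assms by (intro card_mono) auto
  then show "1 \<le> card {k \<in> {1..m}. (q(i := 0)) k \<le> \<alpha> * real 1 / real m}" by simp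
qed (use assms in auto)

text \<open>
  The leave-one-out property. An index that is selected stays below the threshold when its
  adjusted p-value is lowered to \<open>0\<close>; since it is counted at the relevant levels before and
  after the change, the same counts are admissible. On the event that \<open>i\<close> is selected, the
  number of selections thus no longer involves \<open>q i\<close>, whose dependence on the true p-value of
  test point \<open>i\<close> is not controlled.
\<close>

lemma BH_count_upd_zero:
  assumes "0 \<le> \<alpha>" "i \<in> BH \<alpha> m q"
  shows "BH_count \<alpha> m (q(i := 0)) = BH_count \<alpha> m q"
proof (rule antisym)
  let ?l = "BH_count \<alpha> m q" and ?l' = "BH_count \<alpha> m (q(i := 0))"
  have qi: "q i \<le> \<alpha> * real ?l / real m"
    using assms(2) by (simp add: BH_def)
  show le: "?l \<le> ?l'"
  proof (rule BH_count_geI)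
    have "?l \<le> card {k \<in> {1..m}. q k \<le> \<alpha> * real ?l / real m}"
      by (rule BH_count_le_card)
    also have "\<dots> \<le> card {k \<in> {1..m}. (q(i := 0)) k \<le> \<alpha> * real ?l / real m}"
      using assms(1) by (intro card_mono) auto
    finally show "?l \<le> card {k \<in> {1..m}. (q(i := 0)) k \<le> \<alpha> * real ?l / real m}" .
  qed (rule BH_count_le)
  have "\<alpha> * real ?l / real m \<le> \<alpha> * real ?l' / real m"
    using assms(1) le by (intro divide_right_mono mult_left_mono) auto
  with qi have qi': "q i \<le> \<alpha> * real ?l' / real m" by simp
  show "?l' \<le> ?l"
  proof (rule BH_count_geI)
    have "?l' \<le> card {k \<in> {1..m}. (q(i := 0)) k \<le> \<alpha> * real ?l' / real m}"
      by (rule BH_count_le_card)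
    also have "\<dots> \<le> card {k \<in> {1..m}. q k \<le> \<alpha> * real ?l' / real m}"
      using qi' by (intro card_mono) (auto split: if_splits)
    finally show "?l' \<le> card {k \<in> {1..m}. q k \<le> \<alpha> * real ?l' / real m}" .
  qed (rule BH_count_le)
qed

text \<open>
  The contribution of test point \<open>i\<close> to the false coverage proportion when \<open>x\<close> is the p-value
  of its true label: the label is missed exactly when \<open>x\<close> is at most the level at which the
  prediction sets are reported.
\<close>

definition weighted_error :: "real \<Rightarrow> nat \<Rightarrow> (nat \<Rightarrow> real) \<Rightarrow> real \<Rightarrow> nat \<Rightarrow> real" where
  "weighted_error \<alpha> m q x i =
     of_bool (i \<in> BH \<alpha> m q \<and> x \<le> \<alpha> * real (BH_count \<alpha> m q) / real m)
       / max 1 (real (BH_count \<alpha> m q))"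

lemma weighted_error_bounds: "0 \<le> weighted_error \<alpha> m q x i" "weighted_error \<alpha> m q x i \<le> 1"
  by (auto simp: weighted_error_def field_simps)

lemma weighted_error_le:
  fixes q :: "nat \<Rightarrow> real"
  assumes "0 \<le> \<alpha>" "i \<in> {1..m}"
  defines "g \<equiv> real (BH_count \<alpha> m (q(i := 0)))"
  shows "weighted_error \<alpha> m q x i \<le> of_bool (x \<le> \<alpha> / real m * g) / g"
proof (cases "i \<in> BH \<alpha> m q")
  case True
  then show ?thesis
    using BH_count_upd_zero[OF assms(1) True] BH_count_upd_zero_pos[OF assms(1,2), of q]
    by (simp add: weighted_error_def g_def max_def)
qed (auto simp: weighted_error_def g_def)

text \<open>
  The count equals \<open>b\<close> when \<open>b\<close> is admissible and no larger count is, which is a finite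
  Boolean combination of conditions on cardinalities.
\<close>

lemma BH_count_measurable:
  assumes [measurable]: "\<And>i. i \<in> {1..m} \<Longrightarrow> (\<lambda>z. q z i) \<in> borel_measurable M"
  shows "(\<lambda>z. BH_count \<alpha> m (q z)) \<in> M \<rightarrow>\<^sub>M count_space UNIV"
proof -
  have [measurable]: "Measurable.pred M (\<lambda>z. l \<le> card {i \<in> {1..m}. q z i \<le> c})" for l c
  proof -
    have card: "card {i \<in> {1..m}. q z i \<le> c} = (\<Sum>i\<in>{1..m}. if q z i \<le> c then 1 else 0)" for z
      by (simp add: sum.If_cases Int_def)
    have sum: "(\<lambda>z. \<Sum>i\<in>{1..m}. if q z i \<le> c then 1 else 0 :: nat) \<in> M \<rightarrow>\<^sub>M count_space UNIV"
      by (intro measurable_sum_nat measurable_If) measurable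
    show ?thesis unfolding card using sum by measurable
  qed
  have "Measurable.pred M (\<lambda>z. BH_count \<alpha> m (q z) = b)" for b
  proof -
    have eq: "BH_count \<alpha> m (q z) = b \<longleftrightarrow>
        b \<le> m \<and> b \<le> card {i \<in> {1..m}. q z i \<le> \<alpha> * real b / real m} \<and>
        (\<forall>l\<in>{..m}. b < l \<longrightarrow> \<not> l \<le> card {i \<in> {1..m}. q z i \<le> \<alpha> * real l / real m})"
      (is "_ \<longleftrightarrow> ?R") for z
    proof
      assume b: "BH_count \<alpha> m (q z) = b"
      have "\<not> b < l" if "l \<le> m" "l \<le> card {i \<in> {1..m}. q z i \<le> \<alpha> * real l / real m}" for l
        using BH_count_geI[OF that] b by simp
      then show ?R
        using BH_count_le[of \<alpha> m "q z"] BH_count_le_card[of \<alpha> m "q z"] unfolding b by blast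
    next
      assume R: ?R
      then have "b \<le> BH_count \<alpha> m (q z)" by (intro BH_count_geI) blast+
      moreover have "\<not> b < BH_count \<alpha> m (q z)"
        using R BH_count_le[of \<alpha> m "q z"] BH_count_le_card[of \<alpha> m "q z"] by blast
      ultimately show "BH_count \<alpha> m (q z) = b" by simp
    qed
    show ?thesis unfolding eq by measurable
  qed
  then show ?thesis
    by (intro measurable_count_space_eq2_countable[THEN iffD2])
       (auto simp: vimage_def Int_def pred_def conj_commute)
qed

lemma weighted_error_measurable:
  assumes q [measurable]: "\<And>i. i \<in> {1..m} \<Longrightarrow> (\<lambda>z. q z i) \<in> borel_measurable M"
    and [measurable]: "x \<in> borel_measurable M" and i: "i \<in> {1..m}"
  shows "(\<lambda>z. weighted_error \<alpha> m (q z) (x z) i) \<in> borel_measurable M"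
proof -
  note [measurable] = BH_count_measurable[OF q]  q[OF i]
  show ?thesis
    using i unfolding weighted_error_def BH_def mem_Collect_eq by simp
qed

section \<open>Averaging a thresholded rank over exchanges\<close>

text \<open>
  The deterministic core of the argument. Read \<open>card {k \<in> J. s j \<le> s k}\<close> as the rank of the
  score $s_j$ and $g_j$ as the number of selections when $j$ occupies the test position. Among the
  $j$ that satisfy the threshold condition let $a$ have the smallest score. Every such $j$ has
  $g_j \ge g_a$ and belongs to the set counted by the rank of $a$, so the sum is at most that
  rank divided by $g_a$, and this is at most $c$ by the condition at $a$.
\<close>

lemma sum_rank_threshold_le:
  fixes s g :: "'j \<Rightarrow> real"
  assumes "finite J" "0 \<le> c" and pos: "\<And>j. j \<in> J \<Longrightarrow> 0 < g j"
    and mono: "\<And>j j'. j \<in> J \<Longrightarrow> j' \<in> J \<Longrightarrow> s j' \<le> s j \<Longrightarrow> g j' \<le> g j"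
  shows "(\<Sum>j\<in>J. of_bool (real (card {k \<in> J. s j \<le> s k}) \<le> c * g j) / g j) \<le> c"
proof -
  define A where "A = {j \<in> J. real (card {k \<in> J. s j \<le> s k}) \<le> c * g j}"
  have sum_A: "(\<Sum>j\<in>J. of_bool (real (card {k \<in> J. s j \<le> s k}) \<le> c * g j) / g j) = (\<Sum>j\<in>A. 1 / g j)"
    unfolding A_def using assms(1) by (intro sum.mono_neutral_cong_right) auto
  show ?thesis
  proof (cases "A = {}")
    case True
    then show ?thesis using assms(2) by (simp add: sum_A)
  next
    case False
    have "finite A" using assms(1) by (simp add: A_def)
    then obtain a where a: "a \<in> A" and min: "\<And>j. j \<in> A \<Longrightarrow> s a \<le> s j"
      using that[of "arg_min_on s A"] False arg_min_least[of A _ s] arg_min_if_finite(1)[of A s]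
      by blast
    have aJ: "a \<in> J" and ga: "0 < g a" using a pos by (auto simp: A_def)
    have "(\<Sum>j\<in>A. 1 / g j) \<le> (\<Sum>j\<in>A. 1 / g a)"
      using min aJ ga by (intro sum_mono divide_left_mono mono mult_pos_pos pos) (auto simp: A_def)
    also have "\<dots> = real (card A) / g a" by simp
    also have "\<dots> \<le> real (card {k \<in> J. s a \<le> s k}) / g a"
      using ga min assms(1)
      by (intro divide_right_mono of_nat_mono card_mono) (auto simp: A_def)
    also have "\<dots> \<le> c"
      using a ga by (simp add: A_def field_simps)
    finally show ?thesis by (simp add: sum_A)
  qed
qed

text \<open>
  Exchangeability enters only here: an expectation is the expectation of the average over
  law-preserving maps, so it suffices to bound this average outcome by outcome.
\<close>

lemma integral_le_of_orbit_average_le: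
  fixes f :: "'z \<Rightarrow> real"
  assumes M: "prob_space M" and J: "finite J" "J \<noteq> {}"
    and T: "\<And>j. j \<in> J \<Longrightarrow> T j \<in> M \<rightarrow>\<^sub>M M" "\<And>j. j \<in> J \<Longrightarrow> distr M M (T j) = M"
    and f: "integrable M f"
    and avg: "AE z in M. (\<Sum>j\<in>J. f (T j z)) \<le> real (card J) * c"
  shows "(\<integral>z. f z \<partial>M) \<le> c"
proof -
  interpret prob_space M by (rule M)
  have int: "integrable M (\<lambda>z. f (T j z))" and eq: "(\<integral>z. f (T j z) \<partial>M) = (\<integral>z. f z \<partial>M)"
    if "j \<in> J" for j
    using integrable_distr[OF T(1)[OF that], of f] integral_distr[OF T(1)[OF that], of f]
      T(2)[OF that] f by auto
  have "real (card J) * (\<integral>z. f z \<partial>M) = (\<Sum>j\<in>J. (\<integral>z. f (T j z) \<partial>M))"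
    using eq by simp
  also have "\<dots> = (\<integral>z. (\<Sum>j\<in>J. f (T j z)) \<partial>M)"
    using int by (subst Bochner_Integration.integral_sum) auto
  also have "\<dots> \<le> (\<integral>z. real (card J) * c \<partial>M)"
    using int avg by (intro integral_mono_AE) auto
  also have "\<dots> = real (card J) * c" by (simp add: prob_space)
  finally show ?thesis using J by (simp add: card_gt_0_iff)
qed

section \<open>Adjusted p-values\<close>

lemma pred_set_antimono:
  assumes "t \<le> t'" "\<And>y. y \<in> \<Y> \<Longrightarrow> p' i y \<le> p i y"
  shows "pred_set \<Y> p' t' i \<subseteq> pred_set \<Y> p t i"
  using assms unfolding pred_set_def by (auto intro: le_less_trans less_le_trans)

lemma adj_pvalue_le_one: "adj_pvalue \<Y> I p i \<le> 1"
proof -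
  let ?T = "{t \<in> {0<..1}. pred_set \<Y> p t i \<in> I}"
  have "Inf ?T \<le> 1" if "t \<in> ?T" for t
    using that cInf_lower[of t ?T] bdd_belowI[of ?T 0] by fastforce
  then show ?thesis by (auto simp: adj_pvalue_def Let_def)
qed

text \<open>
  Smaller p-values give smaller prediction sets, which become informative earlier. The
  downward closure of \<open>I\<close> is only available inside the class \<open>A\<close> of admissible sets, whence
  the hypotheses that the prediction sets belong to \<open>A\<close>.
\<close>

lemma adj_pvalue_mono:
  assumes down: "\<And>C C'. C \<in> A \<Longrightarrow> C' \<in> A \<Longrightarrow> C' \<subseteq> C \<Longrightarrow> C \<in> I \<Longrightarrow> C' \<in> I"
    and A: "\<And>t. t \<in> {0<..1} \<Longrightarrow> pred_set \<Y> p t i \<in> A" "\<And>t. t \<in> {0<..1} \<Longrightarrow> pred_set \<Y> p' t i \<in> A"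
    and le: "\<And>y. y \<in> \<Y> \<Longrightarrow> p i y \<le> p' i y"
  shows "adj_pvalue \<Y> I p i \<le> adj_pvalue \<Y> I p' i"
proof -
  let ?T = "\<lambda>p. {t \<in> {0<..1}. pred_set \<Y> p t i \<in> I}"
  have "pred_set \<Y> p t i \<subseteq> pred_set \<Y> p' t i" for t
    using le by (intro pred_set_antimono) auto
  then have sub: "?T p' \<subseteq> ?T p"
    using down[OF A(2) A(1)] by blast
  show ?thesis
  proof (cases "?T p' = {}")
    case True
    then show ?thesis using adj_pvalue_le_one[of \<Y> I p i] by (simp add: adj_pvalue_def[of \<Y> I p'] Let_def)
  next
    case False
    moreover have "bdd_below (?T p)" by (rule bdd_belowI[of _ 0]) auto
    ultimately have "Inf (?T p) \<le> Inf (?T p')" using sub by (intro cInf_superset_mono) auto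
    moreover have "?T p \<noteq> {}" using False sub by blast
    ultimately show ?thesis using False unfolding adj_pvalue_def Let_def by presburger
  qed
qed

text \<open>
  Informative levels form an up-set, and right-continuity excludes that this up-set omits its
  infimum. The restriction $t < 1$ leaves room to the right of $t$; it also excludes the
  default value $1$ of an adjusted p-value without any informative level.
\<close>

lemma pred_set_informative_of_adj_pvalue_le:
  assumes down: "\<And>C C'. C \<in> A \<Longrightarrow> C' \<in> A \<Longrightarrow> C' \<subseteq> C \<Longrightarrow> C \<in> I \<Longrightarrow> C' \<in> I"
    and A: "\<And>t. t \<in> {0<..1} \<Longrightarrow> pred_set \<Y> p t i \<in> A"
    and cont: "continuous (at t within {t..1}) (\<lambda>s. of_bool (pred_set \<Y> p s i \<in> I) :: real)"
    and t: "0 < t" "t < 1" and le: "adj_pvalue \<Y> I p i \<le> t"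
  shows "pred_set \<Y> p t i \<in> I"
proof (rule ccontr)
  let ?T = "{t \<in> {0<..1}. pred_set \<Y> p t i \<in> I}"
  assume not: "pred_set \<Y> p t i \<notin> I"
  have ne: "?T \<noteq> {}" using le t by (auto simp: adj_pvalue_def Let_def split: if_splits)
  have inf: "Inf ?T \<le> t" using le ne by (auto simp: adj_pvalue_def Let_def split: if_splits)
  \<comment> \<open>otherwise informativeness would pass from \<open>s\<close> to the smaller prediction set at \<open>t\<close>\<close>
  have above: "t < s" if "s \<in> ?T" for s
  proof (rule ccontr)
    assume "\<not> t < s"
    then have "pred_set \<Y> p t i \<subseteq> pred_set \<Y> p s i" by (intro pred_set_antimono) auto
    then show False using down[OF A A, of s t] that t not by auto
  qed
  have "((\<lambda>s. of_bool (pred_set \<Y> p s i \<in> I) :: real) \<longlongrightarrow> 0) (at t within {t..1})"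
    using cont not by (simp add: continuous_within)
  then have "eventually (\<lambda>s. (of_bool (pred_set \<Y> p s i \<in> I) :: real) < 1) (at t within {t..1})"
    by (rule order_tendstoD) simp
  then obtain d where d: "d > 0"
    and no: "\<And>s. s \<in> {t..1} \<Longrightarrow> s \<noteq> t \<Longrightarrow> dist s t < d \<Longrightarrow> pred_set \<Y> p s i \<notin> I"
    by (auto simp: eventually_at)
  have "Inf ?T < t + d" using inf d by simp
  then obtain s where s: "s \<in> ?T" "s < t + d"
    using cInf_lessD[OF ne] by blast
  show False
    using no[of s] above[OF s(1)] s by (auto simp: dist_real_def)
qed

text \<open>
  With finitely many labels and finitely many possible p-values, the adjusted p-value is a
  function of the graph \<open>G z\<close> of the p-values, a random variable with values in a finite set.
  An arbitrary function of it is therefore measurable.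
\<close>

lemma adj_pvalue_measurable:
  assumes \<Y>: "finite \<Y>" and V: "finite V"
    and p: "\<And>y. y \<in> \<Y> \<Longrightarrow> (\<lambda>z. p z i y) \<in> borel_measurable M"
    and val: "\<And>z y. z \<in> space M \<Longrightarrow> y \<in> \<Y> \<Longrightarrow> p z i y \<in> V"
  shows "(\<lambda>z. adj_pvalue \<Y> I (p z) i) \<in> borel_measurable M"
proof -
  define G where "G z = {(y, v) \<in> \<Y> \<times> V. p z i y = v}" for z
  define h where "h B = adj_pvalue \<Y> I (\<lambda>_ y. THE v. (y, v) \<in> B) i" for B
  have fin: "finite (\<Y> \<times> V)" using \<Y> V by simp
  have G: "G \<in> M \<rightarrow>\<^sub>M count_space (Pow (\<Y> \<times> V))"
  proof (subst measurable_count_space_eq2, goal_cases)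
    case 1
    show ?case using fin by simp
  next
    case 2
    show ?case
    proof (intro conjI ballI)
      show "G \<in> space M \<rightarrow> Pow (\<Y> \<times> V)" by (auto simp: G_def)
      fix B assume "B \<in> Pow (\<Y> \<times> V)"
      then have "G -` {B} \<inter> space M =
          {z \<in> space M. \<forall>x\<in>\<Y> \<times> V. p z i (fst x) = snd x \<longleftrightarrow> x \<in> B}"
        by (auto simp: G_def set_eq_iff)
      also have "\<dots> \<in> sets M"
        using p fin by (intro sets.sets_Collect_finite_All) (auto intro!: sets.sets_Collect simp: mem_Times_iff)
      finally show "G -` {B} \<inter> space M \<in> sets M" .
    qed
  qed
  have "(\<lambda>z. h (G z)) \<in> borel_measurable M"
    by (rule measurable_compose[OF G]) simp
  moreover have "h (G z) = adj_pvalue \<Y> I (p z) i" if "z \<in> space M" for z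
  proof -
    have "(THE v. (y, v) \<in> G z) = p z i y" if "y \<in> \<Y>" for y
      using that val[OF \<open>z \<in> space M\<close> that] by (auto simp: G_def)
    then have "pred_set \<Y> (\<lambda>_ y. THE v. (y, v) \<in> G z) t i = pred_set \<Y> (p z) t i" for t
      by (auto simp: pred_set_def)
    then show ?thesis by (simp add: h_def adj_pvalue_def)
  qed
  ultimately show ?thesis by (simp cong: measurable_cong)
qed

section \<open>Control of the false coverage proportion under exchangeability\<close>

lemma FCP_InfoSP_eq:
  fixes p :: "nat \<Rightarrow> 'y \<Rightarrow> real"
  assumes "0 \<le> \<alpha>" "\<And>i. i \<in> {1..m} \<Longrightarrow> Y (n + i) \<in> \<Y>"
  shows "FCP n (InfoSP \<alpha> m \<Y> I p) Y =
    (\<Sum>i = 1..m. weighted_error \<alpha> m (adj_pvalue \<Y> I p) (p i (Y (n + i))) i)"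
proof -
  let ?q = "adj_pvalue \<Y> I p"
  let ?B = "BH \<alpha> m ?q" and ?l = "BH_count \<alpha> m ?q"
  have sub: "?B \<subseteq> {1..m}" by (auto simp: BH_def)
  have "(\<Sum>i = 1..m. weighted_error \<alpha> m ?q (p i (Y (n + i))) i)
      = (\<Sum>i\<in>?B. weighted_error \<alpha> m ?q (p i (Y (n + i))) i)"
    using sub by (intro sum.mono_neutral_right) (auto simp: weighted_error_def)
  also have "\<dots> = (\<Sum>i\<in>?B. of_bool (Y (n + i) \<notin> pred_set \<Y> p (\<alpha> * real ?l / real m) i) / max 1 (real ?l))"
    using assms sub by (intro sum.cong) (auto simp: weighted_error_def pred_set_def not_less)
  finally show ?thesis
    by (simp add: FCP_def InfoSP_def Let_def card_BH[OF assms(1)] sum_divide_distrib)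
qed

text \<open>
  Both calibration schemes are instances of this theorem. For each test point \<open>i\<close> there is a
  finite set \<open>J i\<close> of positions and, for each \<open>j \<in> J i\<close>, a law-preserving map \<open>T i j\<close> that moves
  the observation at \<open>j\<close> to the test position; \<open>s i z j\<close> is the score of that observation. The
  hypothesis \<open>rank\<close> says that the true p-value after the move is the normalised rank of
  that score, and \<open>comp\<close> that moving a larger score into the test position, thereby taking it out of
  the calibration set, can only lower the p-values of the other test points.

  Fix \<open>i\<close>. By the leave-one-out property its contribution after the move \<open>T i j\<close> is bounded by a
  term of the shape treated in \<open>sum_rank_threshold_le\<close>, with $g_j$ the number of selections when
  $q_i$ is replaced by $0$; \<open>comp\<close> makes $g_j$ increase with the score. Averaging over \<open>J i\<close>
  yields $\alpha / m$, and there are $m$ test points.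
\<close>

theorem InfoSP_controls_FCP:
  fixes M :: "'z measure" and p :: "'z \<Rightarrow> nat \<Rightarrow> 'y \<Rightarrow> real" and Y :: "'z \<Rightarrow> nat \<Rightarrow> 'y"
    and s :: "nat \<Rightarrow> 'z \<Rightarrow> 'j \<Rightarrow> real"
  assumes M: "prob_space M" and \<alpha>: "0 < \<alpha>" "\<alpha> < 1"
    and mono: "monotone_collection M m \<Y> A I p"
    and adm: "AE z in M. \<forall>i\<in>{1..m}. \<forall>t\<in>{0<..1}. pred_set \<Y> (p z) t i \<in> A"
    and lab: "\<And>z i. z \<in> space M \<Longrightarrow> i \<in> {1..m} \<Longrightarrow> Y z (n + i) \<in> \<Y>"
    and q: "\<And>i. i \<in> {1..m} \<Longrightarrow> (\<lambda>z. adj_pvalue \<Y> I (p z) i) \<in> borel_measurable M"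
    and x: "\<And>i. i \<in> {1..m} \<Longrightarrow> (\<lambda>z. p z i (Y z (n + i))) \<in> borel_measurable M"
    and J: "\<And>i. i \<in> {1..m} \<Longrightarrow> finite (J i)" "\<And>i. i \<in> {1..m} \<Longrightarrow> J i \<noteq> {}"
    and T: "\<And>i j. i \<in> {1..m} \<Longrightarrow> j \<in> J i \<Longrightarrow> T i j \<in> M \<rightarrow>\<^sub>M M"
           "\<And>i j. i \<in> {1..m} \<Longrightarrow> j \<in> J i \<Longrightarrow> distr M M (T i j) = M"
    and rank: "\<And>i j z. i \<in> {1..m} \<Longrightarrow> j \<in> J i \<Longrightarrow>
        real (card (J i)) * p (T i j z) i (Y (T i j z) (n + i)) = real (card {k \<in> J i. s i z j \<le> s i z k})"
    and comp: "\<And>i j j' z i' y. i \<in> {1..m} \<Longrightarrow> i' \<in> {1..m} \<Longrightarrow> i' \<noteq> i \<Longrightarrow> j \<in> J i \<Longrightarrow> j' \<in> J i \<Longrightarrow>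
        s i z j' \<le> s i z j \<Longrightarrow> y \<in> \<Y> \<Longrightarrow> p (T i j z) i' y \<le> p (T i j' z) i' y"
  shows "(AE z in M. informative I (InfoSP \<alpha> m \<Y> I (p z)))
       \<and> FCP_controlled M \<alpha> n (\<lambda>z. InfoSP \<alpha> m \<Y> I (p z)) Y"
proof -
  interpret prob_space M by (rule M)
  have down: "C' \<in> I" if "C \<in> A" "C' \<in> A" "C' \<subseteq> C" "C \<in> I" for C C'
    using mono that unfolding monotone_collection_def by blast
  have cont: "AE z in M. \<forall>i\<in>{1..m}. \<forall>t\<in>{0<..1}.
      continuous (at t within {t..1}) (\<lambda>s. of_bool (pred_set \<Y> (p z) s i \<in> I) :: real)"
    using mono unfolding monotone_collection_def by blast
  define q where "q z = adj_pvalue \<Y> I (p z)" for z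
  have q_meas [measurable]: "(\<lambda>z. q z i) \<in> borel_measurable M" if "i \<in> {1..m}" for i
    using q[OF that] by (simp add: q_def)
  define w where "w i z = weighted_error \<alpha> m (q z) (p z i (Y z (n + i))) i" for i z

  have inf: "AE z in M. informative I (InfoSP \<alpha> m \<Y> I (p z))"
    using adm cont
  proof eventually_elim
    case (elim z)
    let ?t = "\<alpha> * real (BH_count \<alpha> m (q z)) / real m"
    have "pred_set \<Y> (p z) ?t i \<in> I" if i: "i \<in> BH \<alpha> m (q z)" for i
    proof -
      have im: "i \<in> {1..m}" and qi: "q z i \<le> ?t" using i by (auto simp: BH_def)
      have "0 < BH_count \<alpha> m (q z)"
        using card_BH[of \<alpha> m "q z"] finite_BH[of \<alpha> m "q z"] i \<alpha> card_gt_0_iff by fastforce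
      then have t0: "0 < ?t" using \<alpha> im by simp
      have "?t \<le> \<alpha> * real m / real m"
        using \<alpha> BH_count_le[of \<alpha> m "q z"] by (intro divide_right_mono mult_left_mono) auto
      also have "\<dots> = \<alpha>" using im by simp
      finally have t1: "?t < 1" using \<alpha>(2) by (rule le_less_trans)
      show ?thesis
      proof (rule pred_set_informative_of_adj_pvalue_le)
        show "C' \<in> I" if "C \<in> A" "C' \<in> A" "C' \<subseteq> C" "C \<in> I" for C C'
          using that by (rule down)
        show "pred_set \<Y> (p z) t i \<in> A" if "t \<in> {0<..1}" for t
          using elim(1) im that by blast
        have "?t \<in> {0<..1}" using t0 t1 by simp
        then show "continuous (at ?t within {?t..1}) (\<lambda>s. of_bool (pred_set \<Y> (p z) s i \<in> I) :: real)"
          using elim(2) im by blast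
        show "adj_pvalue \<Y> I (p z) i \<le> ?t" using qi unfolding q_def .
      qed (rule t0 t1)+
    qed
    then show ?case
      using \<alpha> by (simp add: informative_def InfoSP_def Let_def card_BH q_def)
  qed

  have w_meas [measurable]: "w i \<in> borel_measurable M" if "i \<in> {1..m}" for i
    unfolding w_def using that x[OF that] q_meas by (intro weighted_error_measurable) auto
  have w_int: "integrable M (w i)" if "i \<in> {1..m}" for i
    using that weighted_error_bounds
    by (intro integrable_const_bound[where B = 1] w_meas) (auto simp: w_def abs_le_iff)
  have w_le: "(\<integral>z. w i z \<partial>M) \<le> \<alpha> / real m" if i: "i \<in> {1..m}" for i
  proof (rule integral_le_of_orbit_average_le[OF M J(1)[OF i] J(2)[OF i] T(1)[OF i] T(2)[OF i] w_int[OF i]])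
    \<comment> \<open>admissibility holds almost surely, hence also after each of the finitely many moves\<close>
    have adm_T: "AE z in M. \<forall>j\<in>J i. \<forall>i'\<in>{1..m}. \<forall>t\<in>{0<..1}. pred_set \<Y> (p (T i j z)) t i' \<in> A"
    proof (rule AE_finite_allI[OF J(1)[OF i]])
      fix j assume j: "j \<in> J i"
      show "AE z in M. \<forall>i'\<in>{1..m}. \<forall>t\<in>{0<..1}. pred_set \<Y> (p (T i j z)) t i' \<in> A"
      proof (rule AE_distrD[OF T(1)[OF i j]])
        show "AE z in distr M M (T i j). \<forall>i'\<in>{1..m}. \<forall>t\<in>{0<..1}. pred_set \<Y> (p z) t i' \<in> A"
          unfolding T(2)[OF i j] by (rule adm)
      qed
    qed
    then show "AE z in M. (\<Sum>j\<in>J i. w i (T i j z)) \<le> real (card (J i)) * (\<alpha> / real m)"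
    proof eventually_elim
      case (elim z)
      define g where "g j = real (BH_count \<alpha> m ((q (T i j z))(i := 0)))" for j
      let ?c = "real (card (J i)) * (\<alpha> / real m)"
      have cJ: "0 < real (card (J i))" using J[OF i] by (simp add: card_gt_0_iff)
      have "w i (T i j z) \<le> of_bool (real (card {k \<in> J i. s i z j \<le> s i z k}) \<le> ?c * g j) / g j"
        if j: "j \<in> J i" for j
      proof -
        have eq: "p (T i j z) i (Y (T i j z) (n + i)) \<le> \<alpha> / real m * g j \<longleftrightarrow>
            real (card {k \<in> J i. s i z j \<le> s i z k}) \<le> ?c * g j"
          using mult_le_cancel_left_pos[OF cJ] unfolding rank[OF i j, symmetric] mult.assoc by blast
        have "w i (T i j z) \<le> of_bool (p (T i j z) i (Y (T i j z) (n + i)) \<le> \<alpha> / real m * g j) / g j"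
          using weighted_error_le[of \<alpha> i m "q (T i j z)" "p (T i j z) i (Y (T i j z) (n + i))"] \<alpha> i
          unfolding w_def g_def by simp
        then show ?thesis unfolding eq .
      qed
      then have "(\<Sum>j\<in>J i. w i (T i j z)) \<le>
          (\<Sum>j\<in>J i. of_bool (real (card {k \<in> J i. s i z j \<le> s i z k}) \<le> ?c * g j) / g j)"
        by (rule sum_mono)
      also have "\<dots> \<le> ?c"
      proof (rule sum_rank_threshold_le[OF J(1)[OF i]])
        show "0 \<le> ?c" using \<alpha> by simp
        show "0 < g j" if "j \<in> J i" for j
          using BH_count_upd_zero_pos[of \<alpha> i m] \<alpha> i by (simp add: g_def Suc_le_eq)
        fix j j' assume j: "j \<in> J i" and j': "j' \<in> J i" and ss: "s i z j' \<le> s i z j"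
        have "q (T i j z) i' \<le> q (T i j' z) i'" if "i' \<in> {1..m}" "i' \<noteq> i" for i'
          unfolding q_def
        proof (rule adj_pvalue_mono)
          show "C' \<in> I" if "C \<in> A" "C' \<in> A" "C' \<subseteq> C" "C \<in> I" for C C'
            using that by (rule down)
          show "pred_set \<Y> (p (T i j z)) t i' \<in> A" "pred_set \<Y> (p (T i j' z)) t i' \<in> A"
            if "t \<in> {0<..1}" for t
            using elim j j' \<open>i' \<in> {1..m}\<close> that by blast+
          show "p (T i j z) i' y \<le> p (T i j' z) i' y" if "y \<in> \<Y>" for y
            using comp[OF i \<open>i' \<in> {1..m}\<close> \<open>i' \<noteq> i\<close> j j' ss that] .
        qed
        then have "BH_count \<alpha> m ((q (T i j' z))(i := 0)) \<le> BH_count \<alpha> m ((q (T i j z))(i := 0))"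
          by (intro BH_count_antimono) auto
        then show "g j' \<le> g j" by (simp add: g_def)
      qed
      finally show ?case .
    qed
  qed
  have FCP: "FCP n (InfoSP \<alpha> m \<Y> I (p z)) (Y z) = (\<Sum>i = 1..m. w i z)" if "z \<in> space M" for z
    using FCP_InfoSP_eq[of \<alpha> m "Y z" n \<Y> I "p z"] \<alpha> lab[OF that] by (simp add: w_def q_def)
  have "integrable M (\<lambda>z. \<Sum>i = 1..m. w i z)" using w_int by (intro Bochner_Integration.integrable_sum) auto
  moreover have "(\<integral>z. (\<Sum>i = 1..m. w i z) \<partial>M) \<le> \<alpha>"
  proof -
    have "(\<integral>z. (\<Sum>i = 1..m. w i z) \<partial>M) = (\<Sum>i = 1..m. \<integral>z. w i z \<partial>M)"
      using w_int by (intro Bochner_Integration.integral_sum) auto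
    also have "\<dots> \<le> (\<Sum>i = 1..m. \<alpha> / real m)" using w_le by (intro sum_mono) auto
    also have "\<dots> \<le> \<alpha>" using \<alpha> by simp
    finally show ?thesis .
  qed
  ultimately have "FCP_controlled M \<alpha> n (\<lambda>z. InfoSP \<alpha> m \<Y> I (p z)) Y"
    unfolding FCP_controlled_def
    by (simp add: FCP cong: Bochner_Integration.integrable_cong Bochner_Integration.integral_cong)
  with inf show ?thesis by simp
qed

section \<open>Conformal p-values and exchanges of sample positions\<close>

text \<open>
  The common shape of the full-calibrated and class-calibrated p-values: \<open>D\<close> is the calibration
  set, \<open>\<sigma>\<close> gives its scores and \<open>u\<close> is the score of the test point.
\<close>

definition conformal_pvalue :: "nat set \<Rightarrow> (nat \<Rightarrow> real) \<Rightarrow> real \<Rightarrow> real" where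
  "conformal_pvalue D \<sigma> u = (1 + (\<Sum>k\<in>D. of_bool (u \<le> \<sigma> k))) / (real (card D) + 1)"

lemma full_pvalue_eq:
  "full_pvalue S n X Y i y = conformal_pvalue {1..n} (\<lambda>k. S (Y k) (X k)) (S y (X (n + i)))"
  by (simp add: full_pvalue_def conformal_pvalue_def)

lemma class_pvalue_eq:
  "class_pvalue S n X Y i y =
     conformal_pvalue {k \<in> {1..n}. Y k = y} (\<lambda>k. S y (X k)) (S y (X (n + i)))"
  by (simp add: class_pvalue_def conformal_pvalue_def Let_def)

lemma conformal_pvalue_cong:
  "(\<And>k. k \<in> D \<Longrightarrow> \<sigma> k = \<sigma>' k) \<Longrightarrow> conformal_pvalue D \<sigma> u = conformal_pvalue D \<sigma>' u"
  by (simp add: conformal_pvalue_def)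

lemma conformal_pvalue_value:
  assumes "finite D"
  obtains k where "k \<le> card D + 1" "conformal_pvalue D \<sigma> u = real k / (real (card D) + 1)"
proof
  let ?k = "1 + card {k \<in> D. u \<le> \<sigma> k}"
  show "?k \<le> card D + 1" using card_mono[of D "{k \<in> D. u \<le> \<sigma> k}"] assms by simp
  show "conformal_pvalue D \<sigma> u = real ?k / (real (card D) + 1)"
    using assms by (simp add: conformal_pvalue_def of_bool_def sum.If_cases Int_def)
qed

lemma conformal_pvalue_measurable:
  assumes "\<And>k. k \<in> D \<Longrightarrow> (\<lambda>z. \<sigma> z k) \<in> borel_measurable M" and [measurable]: "u \<in> borel_measurable M"
  shows "(\<lambda>z. conformal_pvalue D (\<sigma> z) (u z)) \<in> borel_measurable M"
proof -
  have "(\<lambda>z. of_bool (u z \<le> \<sigma> z k) :: real) \<in> borel_measurable M" if "k \<in> D" for k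
    using assms(1)[OF that] by measurable
  then show ?thesis
    unfolding conformal_pvalue_def
    by (intro borel_measurable_divide borel_measurable_add borel_measurable_sum) auto
qed

lemma sum_transpose_insert:
  fixes h :: "nat \<Rightarrow> real"
  assumes "finite D" "a \<notin> D" "j \<in> insert a D"
  shows "(\<Sum>k\<in>D. h (Transposition.transpose j a k)) = (\<Sum>k\<in>insert a D. h k) - h j"
proof -
  have "bij_betw (Transposition.transpose j a) D (insert a D - {j})"
    by (rule bij_betw_byWitness[where f' = "Transposition.transpose j a"])
       (use assms in \<open>auto simp: Transposition.transpose_def split: if_splits\<close>)
  then have "(\<Sum>k\<in>D. h (Transposition.transpose j a k)) = (\<Sum>k\<in>insert a D - {j}. h k)"
    by (rule sum.reindex_bij_betw)
  then show ?thesis using assms by (simp add: sum_diff1 del: sum.insert)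
qed

text \<open>
  After the exchange of the calibration position \<open>j\<close> with the test position \<open>a\<close>, the calibration
  scores are those of all positions except \<open>j\<close>. The summand $1$ in the numerator of the p-value
  restores \<open>j\<close>, so that the numerator is the rank of $\sigma_j$ among all positions.
\<close>

lemma conformal_pvalue_transpose_rank:
  assumes "finite D" "a \<notin> D" "j \<in> insert a D"
  shows "real (card (insert a D)) * conformal_pvalue D (\<lambda>k. \<sigma> (Transposition.transpose j a k)) (\<sigma> j)
       = real (card {k \<in> insert a D. \<sigma> j \<le> \<sigma> k})"
proof -
  have "1 + (\<Sum>k\<in>D. of_bool (\<sigma> j \<le> \<sigma> (Transposition.transpose j a k))) =
      (\<Sum>k\<in>insert a D. of_bool (\<sigma> j \<le> \<sigma> k) :: real)"
    using sum_transpose_insert[OF assms, of "\<lambda>k. of_bool (\<sigma> j \<le> \<sigma> k)"] by simp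
  also have "\<dots> = real (card {k \<in> insert a D. \<sigma> j \<le> \<sigma> k})"
    using assms(1) by (simp add: of_bool_def sum.If_cases Int_def del: sum.insert)
  finally show ?thesis
    using assms(1,2) by (simp add: conformal_pvalue_def add.commute[of 1] del: insert_iff)
qed

text \<open>
  The sum over all positions does not depend on the exchange; only the score removed from the
  calibration set does, and removing a larger one lowers the p-value.
\<close>

lemma conformal_pvalue_transpose_mono:
  assumes "finite D" "a \<notin> D" "j \<in> insert a D" "j' \<in> insert a D" "\<sigma> j' \<le> \<sigma> j"
  shows "conformal_pvalue D (\<lambda>k. \<sigma> (Transposition.transpose j a k)) u
       \<le> conformal_pvalue D (\<lambda>k. \<sigma> (Transposition.transpose j' a k)) u"
proof -
  have "of_bool (u \<le> \<sigma> j') \<le> (of_bool (u \<le> \<sigma> j) :: real)"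
    using assms(5) by auto
  then show ?thesis
    unfolding conformal_pvalue_def
    using sum_transpose_insert[OF assms(1-3), of "\<lambda>k. of_bool (u \<le> \<sigma> k)"]
      sum_transpose_insert[OF assms(1,2,4), of "\<lambda>k. of_bool (u \<le> \<sigma> k)"]
    by (intro divide_right_mono) auto
qed

text \<open>
  Product measures live on extensional functions, so the exchanged sample is restricted to the
  index set.
\<close>

definition exchange :: "nat \<Rightarrow> nat \<Rightarrow> nat \<Rightarrow> (nat \<Rightarrow> 'a) \<Rightarrow> nat \<Rightarrow> 'a" where
  "exchange N a b z = (\<lambda>k\<in>{1..N}. z (Transposition.transpose a b k))"

lemma exchange_apply:
  "k \<in> {1..N} \<Longrightarrow> exchange N a b z k = z (Transposition.transpose a b k)"
  by (simp add: exchange_def)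

lemma exchange_invariant:
  assumes M: "\<And>k. k \<in> {1..N} \<Longrightarrow> prob_space (M k)"
    and ab: "a \<in> {1..N}" "b \<in> {1..N}" "M a = M b"
  shows "exchange N a b \<in> PiM {1..N} M \<rightarrow>\<^sub>M PiM {1..N} M"
    and "distr (PiM {1..N} M) (PiM {1..N} M) (exchange N a b) = PiM {1..N} M"
proof -
  let ?t = "Transposition.transpose a b"
  have t: "?t k \<in> {1..N}" "M (?t k) = M k" if "k \<in> {1..N}" for k
    using that ab by (auto simp: Transposition.transpose_def)
  have PiM: "PiM {1..N} (\<lambda>k. M (?t k)) = PiM {1..N} M"
    using t by (intro PiM_cong) auto
  have ex: "exchange N a b = (\<lambda>z. \<lambda>k\<in>{1..N}. z (?t k))"
    by (simp add: exchange_def fun_eq_iff)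
  show "exchange N a b \<in> PiM {1..N} M \<rightarrow>\<^sub>M PiM {1..N} M"
    unfolding ex
  proof (rule measurable_restrict)
    fix k assume k: "k \<in> {1..N}"
    show "(\<lambda>z. z (?t k)) \<in> PiM {1..N} M \<rightarrow>\<^sub>M M k"
      using measurable_component_singleton[OF t(1)[OF k], of M] t(2)[OF k] by simp
  qed
  show "distr (PiM {1..N} M) (PiM {1..N} M) (exchange N a b) = PiM {1..N} M"
    using distr_PiM_reindex[of "{1..N}" M ?t "{1..N}"] M t(1) unfolding PiM ex
    by (auto intro: inj_on_subset[OF inj_transpose])
qed

text \<open>
  For an arbitrary collection of intervals the adjusted p-values may be measurable only up to null
  sets, so in regression the exchange argument has to be run on the completed law.
\<close>

lemma completion_invariant:
  assumes T: "T \<in> M \<rightarrow>\<^sub>M M" and inv: "distr M M T = M"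
  shows "T \<in> completion M \<rightarrow>\<^sub>M completion M"
    and "distr (completion M) (completion M) T = completion M"
proof -
  have d: "distr (completion M) M T = M" using distr_completion[OF T] inv by simp
  show "T \<in> completion M \<rightarrow>\<^sub>M completion M"
    by (rule completion.measurable_completion2) (use measurable_completion[OF T] d in auto)
  show "distr (completion M) (completion M) T = completion M"
    using completion.completion_distr_eq[of T M M] measurable_completion[OF T] d by simp
qed

text \<open>
  All p-values are multiples of $1/(n+1)$, so a prediction set is constant for levels between
  consecutive multiples. The representatives are midpoints because these lie in $(0,1)$, the
  range of levels in the definition of a monotone collection; from the level
  $1$ on the prediction set is empty.
\<close>

lemma pred_set_grid:
  assumes val: "\<And>y. y \<in> Y \<Longrightarrow> \<exists>k\<le>n + 1. p i y = real k / (real n + 1)" and t: "t \<in> {0<..1}"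
  shows "pred_set Y p t i = {} \<or> (\<exists>k\<le>n. pred_set Y p t i = pred_set Y p ((real k + 1/2) / (real n + 1)) i)"
proof -
  define k where "k = nat \<lfloor>t * (real n + 1)\<rfloor>"
  have k: "real k \<le> t * (real n + 1)" "t * (real n + 1) < real k + 1"
    using t by (auto simp: k_def)
  have gt: "t < real v / (real n + 1) \<longleftrightarrow> k < v" for v
  proof -
    have "t < real v / (real n + 1) \<longleftrightarrow> t * (real n + 1) < real v" by (simp add: field_simps)
    also have "\<dots> \<longleftrightarrow> k < v" using k by linarith
    finally show ?thesis .
  qed
  have gt': "(real k + 1/2) / (real n + 1) < real v / (real n + 1) \<longleftrightarrow> k < v" for v :: nat
    by (simp add: divide_less_cancel) linarith
  have eq: "pred_set Y p t i = pred_set Y p ((real k + 1/2) / (real n + 1)) i"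
    using val gt gt' unfolding pred_set_def by (metis (no_types, lifting))
  show ?thesis
  proof (cases "k \<le> n")
    case False
    then have "pred_set Y p t i = {}"
      using val gt unfolding pred_set_def by fastforce
    then show ?thesis by simp
  qed (use eq in auto)
qed

text \<open>
  Interchanges ``for all levels'' and ``almost surely'': by the preceding lemma finitely many
  levels suffice.
\<close>

lemma AE_pred_set_admissible:
  assumes mono: "monotone_collection M m \<Y> A I p" and empty: "{} \<in> A"
    and val: "\<And>z i y. i \<in> {1..m} \<Longrightarrow> y \<in> \<Y> \<Longrightarrow> \<exists>k\<le>n + 1. p z i y = real k / (real n + 1)"
  shows "AE z in M. \<forall>i\<in>{1..m}. \<forall>t\<in>{0<..1}. pred_set \<Y> (p z) t i \<in> A"
proof -
  have "AE z in M. \<forall>k\<in>{..n}. \<forall>i\<in>{1..m}. pred_set \<Y> (p z) ((real k + 1/2) / (real n + 1)) i \<in> A"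
  proof (rule AE_finite_allI)
    fix k assume "k \<in> {..n}"
    then have "(real k + 1/2) / (real n + 1) \<in> {0<..<1}" by (auto simp: field_simps)
    then show "AE z in M. \<forall>i\<in>{1..m}. pred_set \<Y> (p z) ((real k + 1/2) / (real n + 1)) i \<in> A"
      using mono unfolding monotone_collection_def by blast
  qed simp
  then show ?thesis
  proof eventually_elim
    case (elim z)
    show ?case
    proof (intro ballI)
      fix i t assume i: "i \<in> {1..m}" and t: "t \<in> {0<..1::real}"
      show "pred_set \<Y> (p z) t i \<in> A"
        using pred_set_grid[of \<Y> n "p z" i t, OF val[OF i] t] elim i empty by auto
    qed
  qed
qed

text \<open>
  Right-continuity in the label lets one approximate it from the right by the grid
  $\mathbb{Z}/(k+1)$; each approximation takes countably many labels and is therefore jointly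
  measurable.
\<close>

lemma cadlag_joint_measurable:
  fixes S :: "real \<Rightarrow> 'x::topological_space \<Rightarrow> real"
  assumes S: "\<And>y. S y \<in> borel_measurable borel" and c: "\<And>x. cadlag (\<lambda>y. S y x)"
  shows "(\<lambda>w. S (snd w) (fst w)) \<in> borel_measurable (borel \<Otimes>\<^sub>M borel)"
proof (rule borel_measurable_LIMSEQ_real)
  \<comment> \<open>the smallest grid point strictly above \<open>y\<close>, so that the limit in \<open>k\<close> is one from the right\<close>
  define r where "r k y = (of_int \<lfloor>real (Suc k) * y\<rfloor> + 1) / real (Suc k)" for k and y :: real
  have r: "y < r k y" "r k y \<le> y + 1 / real (Suc k)" for k y
  proof -
    have "real (Suc k) * y < of_int \<lfloor>real (Suc k) * y\<rfloor> + 1" by linarith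
    then show "y < r k y" unfolding r_def by (subst pos_less_divide_eq) (auto simp: mult.commute)
    have "of_int \<lfloor>real (Suc k) * y\<rfloor> + 1 \<le> real (Suc k) * y + 1" by linarith
    then have "r k y \<le> (real (Suc k) * y + 1) / real (Suc k)"
      unfolding r_def by (rule divide_right_mono) simp
    then show "r k y \<le> y + 1 / real (Suc k)" by (simp add: add_divide_distrib del: of_nat_Suc)
  qed
  show "(\<lambda>w. S (r k (snd w)) (fst w)) \<in> borel_measurable (borel \<Otimes>\<^sub>M borel)" for k
  proof -
    have "(\<lambda>w::'x \<times> real. S ((of_int l + 1) / real (Suc k)) (fst w)) \<in> borel_measurable (borel \<Otimes>\<^sub>M borel)" for l :: int
      using S by measurable
    moreover have "(\<lambda>w::'x \<times> real. \<lfloor>real (Suc k) * snd w\<rfloor>) \<in> (borel \<Otimes>\<^sub>M borel) \<rightarrow>\<^sub>M count_space UNIV"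
      by measurable
    ultimately show ?thesis
      unfolding r_def by (rule measurable_compose_countable)
  qed
  fix w :: "'x \<times> real"
  let ?y = "snd w"
  have "(\<lambda>k. ?y + 1 / real (Suc k)) \<longlonglongrightarrow> ?y + 0"
    by (intro tendsto_intros LIMSEQ_Suc[OF lim_1_over_n])
  then have "(\<lambda>k. r k ?y) \<longlonglongrightarrow> ?y"
    by (intro tendsto_sandwich[of "\<lambda>_. ?y" "\<lambda>k. r k ?y" sequentially "\<lambda>k. ?y + 1 / real (Suc k)" ?y]
        always_eventually allI less_imp_le[OF r(1)] r(2)) auto
  then have "filterlim (\<lambda>k. r k ?y) (at_right ?y) sequentially"
    unfolding filterlim_at using r(1) by (auto intro!: always_eventually simp: less_imp_neq[THEN not_sym])
  moreover have "((\<lambda>y. S y (fst w)) \<longlongrightarrow> S ?y (fst w)) (at_right ?y)"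
    using c by (simp add: cadlag_def continuous_within)
  ultimately show "(\<lambda>k. S (r k ?y) (fst w)) \<longlonglongrightarrow> S ?y (fst w)"
    by (rule filterlim_compose[rotated])
qed

section \<open>Full-calibrated and class-calibrated p-values\<close>

text \<open>
  Full calibration: test point \<open>i\<close> may be exchanged with every calibration point, each moving
  together with its label.
\<close>

lemma InfoSP_full_pvalue_FCP:
  fixes M :: "(nat \<Rightarrow> 'x \<times> 'y) measure" and S :: "'y \<Rightarrow> 'x \<Rightarrow> real" and n :: nat
  defines "p \<equiv> \<lambda>z. full_pvalue S n (fst \<circ> z) (snd \<circ> z)"
  assumes M: "prob_space M" and \<alpha>: "0 < \<alpha>" "\<alpha> < 1"
    and mono: "monotone_collection M m \<Y> A I p" and empty: "{} \<in> A"
    and lab: "\<And>z k. z \<in> space M \<Longrightarrow> k \<in> {1..n + m} \<Longrightarrow> snd (z k) \<in> \<Y>"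
    and q: "\<And>i. i \<in> {1..m} \<Longrightarrow> (\<lambda>z. adj_pvalue \<Y> I (p z) i) \<in> borel_measurable M"
    and \<sigma>: "\<And>k. k \<in> {1..n + m} \<Longrightarrow> (\<lambda>z. S (snd (z k)) (fst (z k))) \<in> borel_measurable M"
    and T: "\<And>a b. a \<in> {1..n + m} \<Longrightarrow> b \<in> {1..n + m} \<Longrightarrow> exchange (n + m) a b \<in> M \<rightarrow>\<^sub>M M"
      "\<And>a b. a \<in> {1..n + m} \<Longrightarrow> b \<in> {1..n + m} \<Longrightarrow> distr M M (exchange (n + m) a b) = M"
  shows "(AE z in M. informative I (InfoSP \<alpha> m \<Y> I (p z)))
       \<and> FCP_controlled M \<alpha> n (\<lambda>z. InfoSP \<alpha> m \<Y> I (p z)) (\<lambda>z. snd \<circ> z)"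
proof (rule InfoSP_controls_FCP[where J = "\<lambda>i. insert (n + i) {1..n}" and A = A
      and T = "\<lambda>i j. exchange (n + m) j (n + i)" and s = "\<lambda>i z k. S (snd (z k)) (fst (z k))"])
  show "AE z in M. \<forall>i\<in>{1..m}. \<forall>t\<in>{0<..1}. pred_set \<Y> (p z) t i \<in> A"
  proof (rule AE_pred_set_admissible[OF mono empty])
    fix z i y
    show "\<exists>k\<le>n + 1. p z i y = real k / (real n + 1)"
      unfolding p_def full_pvalue_eq by (rule conformal_pvalue_value[of "{1..n}"]) auto
  qed
  show "(\<lambda>z. p z i ((snd \<circ> z) (n + i))) \<in> borel_measurable M" if "i \<in> {1..m}" for i
    unfolding p_def full_pvalue_eq o_def using that
    by (intro conformal_pvalue_measurable \<sigma>) auto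
  show "real (card (insert (n + i) {1..n})) *
      p (exchange (n + m) j (n + i) z) i ((snd \<circ> exchange (n + m) j (n + i) z) (n + i)) =
      real (card {k \<in> insert (n + i) {1..n}. S (snd (z j)) (fst (z j)) \<le> S (snd (z k)) (fst (z k))})"
    if i: "i \<in> {1..m}" and j: "j \<in> insert (n + i) {1..n}" for i j z
  proof -
    have "p (exchange (n + m) j (n + i) z) i ((snd \<circ> exchange (n + m) j (n + i) z) (n + i)) =
      conformal_pvalue {1..n} (\<lambda>k. (\<lambda>k. S (snd (z k)) (fst (z k))) (Transposition.transpose j (n + i) k))
        (S (snd (z j)) (fst (z j)))"
      unfolding p_def full_pvalue_eq using i
      by (auto simp: exchange_apply intro!: conformal_pvalue_cong)
    then show ?thesis
      using conformal_pvalue_transpose_rank[of "{1..n}" "n + i" j "\<lambda>k. S (snd (z k)) (fst (z k))"] i j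
      by simp
  qed
  show "p (exchange (n + m) j (n + i) z) i' y \<le> p (exchange (n + m) j' (n + i) z) i' y"
    if i: "i \<in> {1..m}" "i' \<in> {1..m}" "i' \<noteq> i"
      and j: "j \<in> insert (n + i) {1..n}" "j' \<in> insert (n + i) {1..n}"
      and le: "S (snd (z j')) (fst (z j')) \<le> S (snd (z j)) (fst (z j))" for i i' j j' z y
  proof -
    have "p (exchange (n + m) l (n + i) z) i' y =
      conformal_pvalue {1..n} (\<lambda>k. (\<lambda>k. S (snd (z k)) (fst (z k))) (Transposition.transpose l (n + i) k))
        (S y (fst (z (n + i'))))" if "l \<in> insert (n + i) {1..n}" for l
    proof -
      have "Transposition.transpose l (n + i) (n + i') = n + i'"
        using i that by (auto intro!: transpose_apply_other)
      then show ?thesis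
        unfolding p_def full_pvalue_eq using i
        by (auto simp: exchange_apply intro!: conformal_pvalue_cong)
    qed
    then show ?thesis
      using conformal_pvalue_transpose_mono[of "{1..n}" "n + i" j j' "\<lambda>k. S (snd (z k)) (fst (z k))"] i j le
      by simp
  qed
  show "(snd \<circ> z) (n + i) \<in> \<Y>" if "z \<in> space M" "i \<in> {1..m}" for z i
    using lab[OF that(1), of "n + i"] that(2) by simp
  show "(\<lambda>z. adj_pvalue \<Y> I (p z) i) \<in> borel_measurable M" if "i \<in> {1..m}" for i
    using that by (rule q)
  show "finite (insert (n + i) {1..n})" "insert (n + i) {1..n} \<noteq> {}" for i by simp_all
  fix i j assume "i \<in> {1..m}" "j \<in> insert (n + i) {1..n}"
  then have "j \<in> {1..n + m}" "n + i \<in> {1..n + m}" by auto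
  then show "exchange (n + m) j (n + i) \<in> M \<rightarrow>\<^sub>M M" "distr M M (exchange (n + m) j (n + i)) = M"
    by (rule T)+
qed (rule M \<alpha> mono)+

text \<open>
  Class calibration: test point \<open>i\<close> is only exchanged with calibration points carrying its label,
  which preserves the law although the covariates of different classes may have different
  distributions.
\<close>

lemma InfoSP_class_pvalue_FCP:
  fixes M :: "(nat \<Rightarrow> 'x) measure" and S :: "'y \<Rightarrow> 'x \<Rightarrow> real" and n :: nat and Y :: "nat \<Rightarrow> 'y"
  defines "p \<equiv> \<lambda>X. class_pvalue S n X Y"
  assumes M: "prob_space M" and \<alpha>: "0 < \<alpha>" "\<alpha> < 1"
    and mono: "monotone_collection M m \<Y> (Pow \<Y>) I p"
    and lab: "\<And>k. k \<in> {1..n + m} \<Longrightarrow> Y k \<in> \<Y>"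
    and q: "\<And>i. i \<in> {1..m} \<Longrightarrow> (\<lambda>z. adj_pvalue \<Y> I (p z) i) \<in> borel_measurable M"
    and S: "\<And>k y. k \<in> {1..n + m} \<Longrightarrow> y \<in> \<Y> \<Longrightarrow> (\<lambda>X. S y (X k)) \<in> borel_measurable M"
    and T: "\<And>a b. a \<in> {1..n + m} \<Longrightarrow> b \<in> {1..n + m} \<Longrightarrow> Y a = Y b \<Longrightarrow> exchange (n + m) a b \<in> M \<rightarrow>\<^sub>M M"
      "\<And>a b. a \<in> {1..n + m} \<Longrightarrow> b \<in> {1..n + m} \<Longrightarrow> Y a = Y b \<Longrightarrow>
        distr M M (exchange (n + m) a b) = M"
  shows "(AE X in M. informative I (InfoSP \<alpha> m \<Y> I (p X)))
       \<and> FCP_controlled M \<alpha> n (\<lambda>X. InfoSP \<alpha> m \<Y> I (p X)) (\<lambda>X. Y)"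
proof -
  define D where "D y = {k \<in> {1..n}. Y k = y}" for y
  have D: "finite (D y)" "n + i \<notin> D y" if "i \<in> {1..m}" for y i
    using that by (auto simp: D_def)
  have p_eq: "p X i y = conformal_pvalue (D y) (\<lambda>k. S y (X k)) (S y (X (n + i)))" for X i y
    by (simp add: p_def class_pvalue_eq D_def)
  show ?thesis
  proof (rule InfoSP_controls_FCP[where J = "\<lambda>i. insert (n + i) (D (Y (n + i)))" and A = "Pow \<Y>"
      and T = "\<lambda>i j. exchange (n + m) j (n + i)" and s = "\<lambda>i X k. S (Y (n + i)) (X k)"])
    show "AE X in M. \<forall>i\<in>{1..m}. \<forall>t\<in>{0<..1}. pred_set \<Y> (p X) t i \<in> Pow \<Y>"
      by (auto simp: pred_set_def)
    show "(\<lambda>X. p X i (Y (n + i))) \<in> borel_measurable M" if "i \<in> {1..m}" for i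
      unfolding p_eq using that lab
      by (intro conformal_pvalue_measurable S) (auto simp: D_def)
    show "real (card (insert (n + i) (D (Y (n + i))))) * p (exchange (n + m) j (n + i) X) i (Y (n + i)) =
        real (card {k \<in> insert (n + i) (D (Y (n + i))). S (Y (n + i)) (X j) \<le> S (Y (n + i)) (X k)})"
      if i: "i \<in> {1..m}" and j: "j \<in> insert (n + i) (D (Y (n + i)))" for i j X
    proof -
      have "p (exchange (n + m) j (n + i) X) i (Y (n + i)) =
        conformal_pvalue (D (Y (n + i))) (\<lambda>k. (\<lambda>k. S (Y (n + i)) (X k)) (Transposition.transpose j (n + i) k))
          (S (Y (n + i)) (X j))"
        unfolding p_eq using i
        by (auto simp: exchange_apply D_def intro!: conformal_pvalue_cong)
      then show ?thesis
        using conformal_pvalue_transpose_rank[OF D[OF i] j, of "\<lambda>k. S (Y (n + i)) (X k)"] by simp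
    qed
    show "p (exchange (n + m) j (n + i) X) i' y \<le> p (exchange (n + m) j' (n + i) X) i' y"
      if i: "i \<in> {1..m}" "i' \<in> {1..m}" "i' \<noteq> i"
        and j: "j \<in> insert (n + i) (D (Y (n + i)))" "j' \<in> insert (n + i) (D (Y (n + i)))"
        and le: "S (Y (n + i)) (X j') \<le> S (Y (n + i)) (X j)" for i i' j j' X y
    proof -
      have swap: "p (exchange (n + m) l (n + i) X) i' y =
        conformal_pvalue (D y) (\<lambda>k. S y (X (Transposition.transpose l (n + i) k))) (S y (X (n + i')))"
        if "l \<in> insert (n + i) (D (Y (n + i)))" for l
      proof -
        have "Transposition.transpose l (n + i) (n + i') = n + i'"
          using i that by (auto intro!: transpose_apply_other simp: D_def)
        then show ?thesis
          unfolding p_eq using i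
          by (auto simp: exchange_apply D_def intro!: conformal_pvalue_cong)
      qed
      show ?thesis
      proof (cases "y = Y (n + i)")
        case True
        then show ?thesis
          using conformal_pvalue_transpose_mono[OF D[OF i(1)] j, of "\<lambda>k. S (Y (n + i)) (X k)"] le
          unfolding swap[OF j(1)] swap[OF j(2)] by simp
      next
        case False
        \<comment> \<open>the exchange moves only points of class \<open>Y (n + i)\<close>, hence no calibration point of class \<open>y\<close>\<close>
        have "Transposition.transpose l (n + i) k = k"
          if "k \<in> D y" "l \<in> insert (n + i) (D (Y (n + i)))" for k l
          using False that i by (auto intro!: transpose_apply_other simp: D_def)
        then show ?thesis
          unfolding swap[OF j(1)] swap[OF j(2)] using j
          by (intro eq_refl conformal_pvalue_cong) simp
      qed
    qed
    show "(\<lambda>X. adj_pvalue \<Y> I (p X) i) \<in> borel_measurable M" if "i \<in> {1..m}" for i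
      using that by (rule q)
    show "Y (n + i) \<in> \<Y>" if "i \<in> {1..m}" for i using that by (intro lab) simp
    show "finite (insert (n + i) (D (Y (n + i))))" "insert (n + i) (D (Y (n + i))) \<noteq> {}"
      if "i \<in> {1..m}" for i
      using D(1)[OF that] by simp_all
    fix i j assume i: "i \<in> {1..m}" and j: "j \<in> insert (n + i) (D (Y (n + i)))"
    have "j \<in> {1..n + m}" "n + i \<in> {1..n + m}" "Y j = Y (n + i)" using i j by (auto simp: D_def)
    then show "exchange (n + m) j (n + i) \<in> M \<rightarrow>\<^sub>M M" "distr M M (exchange (n + m) j (n + i)) = M"
      using T by blast+
  qed (rule M \<alpha> mono)+
qed

lemma full_pvalue_adj_measurable:
  fixes M :: "(nat \<Rightarrow> 'x \<times> 'y) measure"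
  assumes "finite \<Y>" and i: "i \<in> {1..m}"
    and \<sigma>: "\<And>k. k \<in> {1..n + m} \<Longrightarrow> (\<lambda>z. S (snd (z k)) (fst (z k))) \<in> borel_measurable M"
    and S: "\<And>k y. k \<in> {1..n + m} \<Longrightarrow> y \<in> \<Y> \<Longrightarrow> (\<lambda>z. S y (fst (z k))) \<in> borel_measurable M"
  shows "(\<lambda>z. adj_pvalue \<Y> I (full_pvalue S n (fst \<circ> z) (snd \<circ> z)) i) \<in> borel_measurable M"
proof (rule adj_pvalue_measurable[OF assms(1), where V = "(\<lambda>k. real k / (real n + 1)) ` {..n + 1}"])
  show "(\<lambda>z. full_pvalue S n (fst \<circ> z) (snd \<circ> z) i y) \<in> borel_measurable M" if "y \<in> \<Y>" for y
    unfolding full_pvalue_eq o_def using i that by (intro conformal_pvalue_measurable \<sigma> S) auto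
  show "full_pvalue S n (fst \<circ> z) (snd \<circ> z) i y \<in> (\<lambda>k. real k / (real n + 1)) ` {..n + 1}" for z y
    unfolding full_pvalue_eq by (rule conformal_pvalue_value[of "{1..n}"]) auto
qed simp

lemma class_pvalue_adj_measurable:
  fixes M :: "(nat \<Rightarrow> 'x) measure"
  assumes "finite \<Y>" and i: "i \<in> {1..m}"
    and S: "\<And>k y. k \<in> {1..n + m} \<Longrightarrow> y \<in> \<Y> \<Longrightarrow> (\<lambda>X. S y (X k)) \<in> borel_measurable M"
  shows "(\<lambda>X. adj_pvalue \<Y> I (class_pvalue S n X Y) i) \<in> borel_measurable M"
proof (rule adj_pvalue_measurable[OF assms(1),
      where V = "(\<lambda>(k, d). real k / (real d + 1)) ` ({..n + 1} \<times> {..n})"])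
  show "(\<lambda>X. class_pvalue S n X Y i y) \<in> borel_measurable M" if "y \<in> \<Y>" for y
    unfolding class_pvalue_eq using i that by (intro conformal_pvalue_measurable S) auto
  fix X y
  let ?D = "{k \<in> {1..n}. Y k = y}"
  have "card ?D \<le> n" using card_mono[of "{1..n}" ?D] by (simp add: subset_iff)
  moreover obtain k where "k \<le> card ?D + 1"
    "class_pvalue S n X Y i y = real k / (real (card ?D) + 1)"
    unfolding class_pvalue_eq by (rule conformal_pvalue_value[of ?D]) auto
  ultimately show "class_pvalue S n X Y i y \<in> (\<lambda>(k, d). real k / (real d + 1)) ` ({..n + 1} \<times> {..n})"
    by (intro image_eqI[where x = "(k, card ?D)"]) auto
qed simp

section \<open>The three sampling models\<close>

lemma InfoSP_regression:
  fixes P :: "('x::topological_space \<times> real) measure" and S :: "real \<Rightarrow> 'x \<Rightarrow> real" and I :: "real set set"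
  assumes \<alpha>: "0 < \<alpha>" "\<alpha> < 1" and P: "prob_space P" and sets: "sets P = sets (borel \<Otimes>\<^sub>M borel)"
    and S: "\<forall>y. S y \<in> borel_measurable borel" "\<forall>x. cadlag (\<lambda>y. S y x)"
    and mono: "monotone_collection (completion (iid_law (n + m) P)) m UNIV {C. is_interval C} I
        (\<lambda>z. full_pvalue S n (fst \<circ> z) (snd \<circ> z))"
    and q: "\<forall>i\<in>{1..m}. (\<lambda>z. adj_pvalue UNIV I (full_pvalue S n (fst \<circ> z) (snd \<circ> z)) i)
        \<in> borel_measurable (completion (iid_law (n + m) P))"
  shows "(AE z in completion (iid_law (n + m) P). informative I (InfoSP \<alpha> m UNIV I (full_pvalue S n (fst \<circ> z) (snd \<circ> z)))) \<and>
      FCP_controlled (completion (iid_law (n + m) P)) \<alpha> n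
        (\<lambda>z. InfoSP \<alpha> m UNIV I (full_pvalue S n (fst \<circ> z) (snd \<circ> z))) (\<lambda>z. snd \<circ> z)"
proof -
  let ?M = "iid_law (n + m) P"
  have M: "prob_space ?M" unfolding iid_law_def using P by (rule prob_space_PiM)
  show "(AE z in completion ?M. informative I (InfoSP \<alpha> m UNIV I (full_pvalue S n (fst \<circ> z) (snd \<circ> z)))) \<and>
      FCP_controlled (completion ?M) \<alpha> n (\<lambda>z. InfoSP \<alpha> m UNIV I (full_pvalue S n (fst \<circ> z) (snd \<circ> z)))
        (\<lambda>z. snd \<circ> z)"
  proof (rule InfoSP_full_pvalue_FCP[OF _ \<alpha> mono])
    show "prob_space (completion ?M)"
      using prob_space.emeasure_space_1[OF M] by (intro prob_spaceI) simp
    show "(\<lambda>z. S (snd (z k)) (fst (z k))) \<in> borel_measurable (completion ?M)" if "k \<in> {1..n + m}" for k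
    proof (rule measurable_completion)
      have "(\<lambda>w. S (snd w) (fst w)) \<in> borel_measurable P"
        using cadlag_joint_measurable[of S] S sets by (simp cong: measurable_cong_sets)
      from measurable_compose[OF measurable_component_singleton[OF that] this]
      show "(\<lambda>z. S (snd (z k)) (fst (z k))) \<in> borel_measurable ?M"
        by (simp add: iid_law_def)
    qed
    show "(\<lambda>z. adj_pvalue UNIV I (full_pvalue S n (fst \<circ> z) (snd \<circ> z)) i)
      \<in> borel_measurable (completion ?M)" if "i \<in> {1..m}" for i
      using q that by (rule bspec)
    fix a b assume "a \<in> {1..n + m}" "b \<in> {1..n + m}"
    then have "exchange (n + m) a b \<in> ?M \<rightarrow>\<^sub>M ?M" "distr ?M ?M (exchange (n + m) a b) = ?M"
      unfolding iid_law_def by (rule exchange_invariant[OF P _ _ refl]; assumption)+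
    then show "exchange (n + m) a b \<in> completion ?M \<rightarrow>\<^sub>M completion ?M"
      "distr (completion ?M) (completion ?M) (exchange (n + m) a b) = completion ?M"
      by (rule completion_invariant)+
  qed simp_all
qed

text \<open>
  With finitely many labels the adjusted p-values are random variables on the product space
  itself, whatever the informative collection.
\<close>

lemma InfoSP_iid_classification:
  fixes P :: "('x::topological_space \<times> 'y) measure" and S :: "'y \<Rightarrow> 'x \<Rightarrow> real" and I :: "'y set set"
  assumes \<alpha>: "0 < \<alpha>" "\<alpha> < 1" and \<Y>: "finite \<Y>"
    and P: "prob_space P" and sets: "sets P = sets (borel \<Otimes>\<^sub>M count_space \<Y>)"
    and S: "\<forall>y\<in>\<Y>. S y \<in> borel_measurable borel"
    and mono: "monotone_collection (iid_law (n + m) P) m \<Y> (Pow \<Y>) I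
        (\<lambda>z. full_pvalue S n (fst \<circ> z) (snd \<circ> z))"
  shows "(AE z in iid_law (n + m) P. informative I (InfoSP \<alpha> m \<Y> I (full_pvalue S n (fst \<circ> z) (snd \<circ> z)))) \<and>
      FCP_controlled (iid_law (n + m) P) \<alpha> n
        (\<lambda>z. InfoSP \<alpha> m \<Y> I (full_pvalue S n (fst \<circ> z) (snd \<circ> z))) (\<lambda>z. snd \<circ> z)"
proof -
  let ?M = "iid_law (n + m) P"
  have comp: "(\<lambda>z. f (z k)) \<in> borel_measurable ?M"
    if "k \<in> {1..n + m}" "f \<in> borel_measurable (borel \<Otimes>\<^sub>M count_space \<Y>)" for k and f :: "'x \<times> 'y \<Rightarrow> real"
  proof -
    have "f \<in> borel_measurable P" using that(2) sets by (simp cong: measurable_cong_sets)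
    from measurable_compose[OF measurable_component_singleton[OF that(1)] this]
    show ?thesis by (simp add: iid_law_def)
  qed
  have \<sigma>: "(\<lambda>z. S (snd (z k)) (fst (z k))) \<in> borel_measurable ?M" if "k \<in> {1..n + m}" for k
  proof (rule comp[OF that])
    show "(\<lambda>w. S (snd w) (fst w)) \<in> borel_measurable (borel \<Otimes>\<^sub>M count_space \<Y>)"
    proof (rule measurable_compose_countable'[where I = "\<Y>" and g = snd and f = "\<lambda>y w. S y (fst w)"])
      fix y assume "y \<in> \<Y>"
      then show "(\<lambda>w. S y (fst w)) \<in> borel_measurable (borel \<Otimes>\<^sub>M count_space \<Y>)"
        using S by (intro measurable_compose[OF measurable_fst]) blast
    qed (use \<Y> in \<open>auto simp: countable_finite\<close>)
  qed
  have Sy: "(\<lambda>z. S y (fst (z k))) \<in> borel_measurable ?M" if "k \<in> {1..n + m}" "y \<in> \<Y>" for k y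
  proof (rule comp[OF that(1), of "\<lambda>w. S y (fst w)"])
    show "(\<lambda>w. S y (fst w)) \<in> borel_measurable (borel \<Otimes>\<^sub>M count_space \<Y>)"
      using S that(2) by (intro measurable_compose[OF measurable_fst]) blast
  qed
  show "(AE z in ?M. informative I (InfoSP \<alpha> m \<Y> I (full_pvalue S n (fst \<circ> z) (snd \<circ> z)))) \<and>
      FCP_controlled ?M \<alpha> n (\<lambda>z. InfoSP \<alpha> m \<Y> I (full_pvalue S n (fst \<circ> z) (snd \<circ> z)))
        (\<lambda>z. snd \<circ> z)"
  proof (rule InfoSP_full_pvalue_FCP[OF _ \<alpha> mono])
    show "prob_space ?M" unfolding iid_law_def using P by (rule prob_space_PiM)
    show "(\<lambda>z. adj_pvalue \<Y> I (full_pvalue S n (fst \<circ> z) (snd \<circ> z)) i) \<in> borel_measurable ?M"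
      if "i \<in> {1..m}" for i
      by (rule full_pvalue_adj_measurable[OF \<Y> that \<sigma> Sy])
    fix z k assume "z \<in> space ?M" and k: "k \<in> {1..n + m}"
    then have "z \<in> PiE {1..n + m} (\<lambda>_. space P)" by (simp only: iid_law_def space_PiM)
    then have "z k \<in> space P" using k by (rule PiE_mem)
    also have "space P = UNIV \<times> \<Y>"
      using sets_eq_imp_space_eq[OF sets] by (simp add: space_pair_measure)
    finally show "snd (z k) \<in> \<Y>" by (simp add: mem_Times_iff)
  next
    fix a b assume "a \<in> {1..n + m}" "b \<in> {1..n + m}"
    then show "exchange (n + m) a b \<in> ?M \<rightarrow>\<^sub>M ?M" "distr ?M ?M (exchange (n + m) a b) = ?M"
      unfolding iid_law_def by (rule exchange_invariant[OF P _ _ refl]; assumption)+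
  qed (simp, rule \<sigma>)
qed

lemma InfoSP_class_conditional:
  fixes PX :: "'y \<Rightarrow> ('x::topological_space) measure" and Y :: "nat \<Rightarrow> 'y"
    and S :: "'y \<Rightarrow> 'x \<Rightarrow> real" and I :: "'y set set"
  assumes \<alpha>: "0 < \<alpha>" "\<alpha> < 1" and \<Y>: "finite \<Y>"
    and PX: "\<forall>k\<in>\<Y>. prob_space (PX k) \<and> sets (PX k) = sets borel"
    and Y: "\<forall>j\<in>{1..n + m}. Y j \<in> \<Y>"
    and S: "\<forall>y\<in>\<Y>. S y \<in> borel_measurable borel"
    and mono: "monotone_collection (class_cond_law (n + m) PX Y) m \<Y> (Pow \<Y>) I
        (\<lambda>X. class_pvalue S n X Y)"
  shows "(AE X in class_cond_law (n + m) PX Y. informative I (InfoSP \<alpha> m \<Y> I (class_pvalue S n X Y))) \<and>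
      FCP_controlled (class_cond_law (n + m) PX Y) \<alpha> n
        (\<lambda>X. InfoSP \<alpha> m \<Y> I (class_pvalue S n X Y)) (\<lambda>X. Y)"
proof -
  let ?M = "class_cond_law (n + m) PX Y"
  have prob: "prob_space (PX (Y k))" if "k \<in> {1..n + m}" for k using PX Y that by blast
  have Sy: "(\<lambda>X. S y (X k)) \<in> borel_measurable ?M" if k: "k \<in> {1..n + m}" and y: "y \<in> \<Y>" for k y
  proof -
    have "sets (PX (Y k)) = sets borel" using PX Y k by blast
    then have "S y \<in> borel_measurable (PX (Y k))"
      using S y by (simp cong: measurable_cong_sets)
    from measurable_compose[OF measurable_component_singleton[OF k, of "\<lambda>j. PX (Y j)"] this]
    show ?thesis by (simp add: class_cond_law_def)
  qed
  show "(AE X in ?M. informative I (InfoSP \<alpha> m \<Y> I (class_pvalue S n X Y))) \<and>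
      FCP_controlled ?M \<alpha> n (\<lambda>X. InfoSP \<alpha> m \<Y> I (class_pvalue S n X Y)) (\<lambda>X. Y)"
  proof (rule InfoSP_class_pvalue_FCP[OF _ \<alpha> mono])
    show "prob_space ?M" unfolding class_cond_law_def by (rule prob_space_PiM) (rule prob)
    show "(\<lambda>X. adj_pvalue \<Y> I (class_pvalue S n X Y) i) \<in> borel_measurable ?M"
      if "i \<in> {1..m}" for i
      by (rule class_pvalue_adj_measurable[OF \<Y> that Sy])
    show "Y k \<in> \<Y>" if "k \<in> {1..n + m}" for k using Y that by (rule bspec)
    fix a b assume "a \<in> {1..n + m}" "b \<in> {1..n + m}" "Y a = Y b"
    then have *: "a \<in> {1..n + m}" "b \<in> {1..n + m}" "PX (Y a) = PX (Y b)" by simp_all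
    show "exchange (n + m) a b \<in> ?M \<rightarrow>\<^sub>M ?M" "distr ?M ?M (exchange (n + m) a b) = ?M"
      unfolding class_cond_law_def by (rule exchange_invariant[OF prob *]; assumption)+
  qed (rule Sy)
qed

theorem theorem3p1:
  fixes \<alpha> :: real and n m :: nat
  assumes "0 < \<alpha>" and "\<alpha> < 1"
  shows
    \<comment> \<open>(a), regression; the adjusted p-values are assumed to be random variables (up to null
        sets), which for an arbitrary collection of intervals is not automatic\<close>
    "(\<forall>(P :: ((real ^ 'd) \<times> real) measure) (S :: real \<Rightarrow> (real ^ 'd) \<Rightarrow> real) (I :: real set set).
        let M = completion (iid_law (n + m) P);
            p = (\<lambda>z. full_pvalue S n (fst \<circ> z) (snd \<circ> z));
            R = (\<lambda>z. InfoSP \<alpha> m UNIV I (p z))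
        in prob_space P \<longrightarrow> sets P = sets (borel \<Otimes>\<^sub>M borel) \<longrightarrow>
           (\<forall>y. S y \<in> borel_measurable borel) \<longrightarrow>
           (\<forall>x. cadlag (\<lambda>y. S y x)) \<longrightarrow>
           (AE z in M. inj_on (\<lambda>j. S (snd (z j)) (fst (z j))) {1..n + m}) \<longrightarrow>
           I \<subseteq> {C. is_interval C} \<longrightarrow>
           monotone_collection M m UNIV {C. is_interval C} I p \<longrightarrow>
           (\<forall>i\<in>{1..m}. (\<lambda>z. adj_pvalue UNIV I (p z) i) \<in> borel_measurable M) \<longrightarrow>
           (AE z in M. informative I (R z)) \<and> FCP_controlled M \<alpha> n R (\<lambda>z. snd \<circ> z))
     \<and>
     \<comment> \<open>(a), classification\<close>
     (\<forall>(K :: nat) (P :: ((real ^ 'd) \<times> nat) measure) (S :: nat \<Rightarrow> (real ^ 'd) \<Rightarrow> real)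
        (I :: nat set set).
        let M = iid_law (n + m) P;
            p = (\<lambda>z. full_pvalue S n (fst \<circ> z) (snd \<circ> z));
            R = (\<lambda>z. InfoSP \<alpha> m {1..K} I (p z))
        in prob_space P \<longrightarrow> sets P = sets (borel \<Otimes>\<^sub>M count_space {1..K}) \<longrightarrow>
           (\<forall>y\<in>{1..K}. S y \<in> borel_measurable borel) \<longrightarrow>
           (AE z in M. inj_on (\<lambda>j. S (snd (z j)) (fst (z j))) {1..n + m}) \<longrightarrow>
           I \<subseteq> Pow {1..K} \<longrightarrow>
           monotone_collection M m {1..K} (Pow {1..K}) I p \<longrightarrow>
           (AE z in M. informative I (R z)) \<and> FCP_controlled M \<alpha> n R (\<lambda>z. snd \<circ> z))
     \<and>
     \<comment> \<open>(b), classification\<close>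
     (\<forall>(K :: nat) (PX :: nat \<Rightarrow> (real ^ 'd) measure) (Y :: nat \<Rightarrow> nat)
        (S :: nat \<Rightarrow> (real ^ 'd) \<Rightarrow> real) (I :: nat set set).
        let M = class_cond_law (n + m) PX Y;
            p = (\<lambda>X. class_pvalue S n X Y);
            R = (\<lambda>X. InfoSP \<alpha> m {1..K} I (p X))
        in (\<forall>k\<in>{1..K}. prob_space (PX k) \<and> sets (PX k) = sets borel) \<longrightarrow>
           (\<forall>j\<in>{1..n + m}. Y j \<in> {1..K}) \<longrightarrow>
           (\<forall>y\<in>{1..K}. S y \<in> borel_measurable borel) \<longrightarrow>
           (AE X in M. inj_on (\<lambda>j. S (Y j) (X j)) {1..n + m}) \<longrightarrow>
           I \<subseteq> Pow {1..K} \<longrightarrow>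
           monotone_collection M m {1..K} (Pow {1..K}) I p \<longrightarrow>
           (AE X in M. informative I (R X)) \<and> FCP_controlled M \<alpha> n R (\<lambda>X. Y))"
  unfolding Let_def
\<comment> \<open>the instances of conjunction introduction split off the three parts, but not their conclusions\<close>
proof (intro conjI[of "\<forall>P. _ P"] conjI[of "\<forall>K. _ K"] allI impI, goal_cases)
  case (1 P S I)
  show ?case by (rule InfoSP_regression[OF assms 1(1-4,7,8)])
next
  case (2 K P S I)
  show ?case by (rule InfoSP_iid_classification[OF assms _ 2(1-3,6)]) simp
next
  case (3 K PX Y S I)
  show ?case by (rule InfoSP_class_conditional[OF assms _ 3(1-3,6)]) simp
qed

end
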